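(* Let $\mathcal{A}=\{0,1\}$, and let $\mu_0$ be the probability measure on $\mathcal{A}$ given by $\mu_0(\{0\})=\beta$ and $\mu_0(\{1\})=1-\beta$, where $\beta\in(0,1)$ is transcendental. Let $(\Omega,T,\mu)$ be the full shift generated by $(\mathcal{A},\mu_0)$. Then there exists $\ell\in\mathfrak{S}_0(\Omega,T,\mu)$ such that $\mathrm{OG}_{\mathrm{diag}}(\ell)=\emptyset$; that is, $\mathrm{DL}(\Omega,T,\mu)\subsetneq\mathfrak{S}_0(\Omega,T,\mu)$.
   Context: Full shift: for compact $\mathcal{A}\subseteq\mathbb{R}$ and a Borel probability measure $\mu_0$ with $\operatorname{supp}\mu_0=\mathcal{A}$, the full shift generated by $(\mathcal{A},\mu_0)$ is $(\Omega,T,\mu)$ with $\Omega=\mathcal{A}^{\mathbb{Z}}$ (product topology), $[T\omega]_n=\omega_{n+1}$, $\mu=\mu_0^{\mathbb{Z}}$. Diagonal operators: for $\mathfrak{q}\in C(\Omega,\mathbb{R})$ and $\omega\in\Omega$, $V_\omega=V_{\mathfrak{q},\omega}$ acts on $\ell^2(\mathbb{Z})$ by $[V_\omega\psi](n)=\mathfrak{q}(T^n\omega)\psi(n)$. There is a compact set $\Sigma_{\mathfrak{q},0}\subseteq\mathbb{R}$ (the almost-sure spectrum) with $\sigma(V_{\mathfrak{q},\omega})=\Sigma_{\mathfrak{q},0}$ for $\mu$-a.e. $\omega$. The density of states measure $\kappa$ is defined by $\int h\,d\kappa=\int_\Omega\langle\delta_0,h(V_\omega)\delta_0\rangle\,d\mu(\omega)$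 for $h\in C(\mathbb{R})$, and the integrated density of states is $k_{\mathfrak{q},0}(E)=\kappa((-\infty,E])$. Schwartzman group: the suspension $(X,\tau,\nu)$ of $(\Omega,T,\mu)$ is $X=(\Omega\times\mathbb{R})/\!\sim$ with $(T^n\omega,t)\sim(\omega,t+n)$, $\tau^s([\omega,t])=[\omega,s+t]$, $\int_X f\,d\nu=\int_\Omega\int_0^1 f([\omega,t])\,dt\,d\mu(\omega)$. For continuous $\phi:X\to\mathbb{T}=\mathbb{R}/\mathbb{Z}$ and $x\in X$, let $\widetilde\phi_x:\mathbb{R}\to\mathbb{R}$ be a continuous lift of $t\mapsto\phi(\tau^tx)$; $\lim_{t\to\infty}\widetilde\phi_x(t)/t$ exists for $\nu$-a.e. $x$, is a.e. constant and depends only on the homotopy class of $\phi$; call the value $\mathfrak{A}_\nu(\phi)$. The Schwartzman group $\mathfrak{S}(\Omega,T,\mu)\subseteq\mathbb{R}$ is the set of all values $\mathfrak{A}_\nu(\phi)$, and $\mathfrak{S}_0(\Omega,T,\mu)=\mathfrak{S}(\Omega,T,\mu)\cap(0,1)$. Gaps and labels: for $\ell\in\mathfrak{S}_0$, $\mathrm{OG}_{\mathrm{diag}}(\ell)$ is the set of $\mathfrak{q}\in C(\Omega,\mathbb{R})$ such that $\Sigma_{\mathfrak{q},0}$ has an open gap with label $\ell$, meaning that there is a bounded connected component $I$ of $\mathbb{R}\setminus\Sigma_{\mathfrak{q},0}$ with $k_{\mathfrak{q},0}(E)=\ell$ for $E\in I$. $\mathrm{DL}(\Omega,T,\mu)=\{\ell\in\mathfrak{S}_0(\Omega,T,\mu):\mathrm{OG}_{\mathrm{diag}}(\ell)\ne\emptyset\}$.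 *)

theory Defs
  imports "HOL-Probability.Probability"
begin

section \<open>The Hilbert space of square-summable complex functions on the integers\<close>

typedef ell2 = "{\<psi> :: int \<Rightarrow> complex. (\<lambda>n. (cmod (\<psi> n))\<^sup>2) summable_on UNIV}"
  morphisms ell2_fun Abs_ell2
  by (rule exI[of _ "\<lambda>_. 0"]) simp

setup_lifting type_definition_ell2

lemma ell2_add_aux:
  fixes \<phi> \<psi> :: "int \<Rightarrow> complex"
  assumes "(\<lambda>n. (cmod (\<phi> n))\<^sup>2) summable_on UNIV" "(\<lambda>n. (cmod (\<psi> n))\<^sup>2) summable_on UNIV"
  shows "(\<lambda>n. (cmod (\<phi> n + \<psi> n))\<^sup>2) summable_on UNIV"
proof (rule summable_on_comparison_test)
  show "(\<lambda>n. 2 * (cmod (\<phi> n))\<^sup>2 + 2 * (cmod (\<psi> n))\<^sup>2) summable_on UNIV"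
    by (intro summable_on_add summable_on_cmult_right assms)
  fix n
  have "(cmod (\<phi> n + \<psi> n))\<^sup>2 \<le> (cmod (\<phi> n) + cmod (\<psi> n))\<^sup>2"
    by (intro power_mono norm_triangle_ineq) auto
  also have "\<dots> \<le> 2 * (cmod (\<phi> n))\<^sup>2 + 2 * (cmod (\<psi> n))\<^sup>2"
    using sum_squares_bound[of "cmod (\<phi> n)" "cmod (\<psi> n)"] by (simp add: power2_sum)
  finally show "(cmod (\<phi> n + \<psi> n))\<^sup>2 \<le> 2 * (cmod (\<phi> n))\<^sup>2 + 2 * (cmod (\<psi> n))\<^sup>2" .
qed simp

lemma ell2_mult_aux:
  fixes d \<psi> :: "int \<Rightarrow> complex"
  assumes "(\<lambda>n. (cmod (\<psi> n))\<^sup>2) summable_on UNIV" "\<And>n. cmod (d n) \<le> K"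
  shows "(\<lambda>n. (cmod (d n * \<psi> n))\<^sup>2) summable_on UNIV"
proof (rule summable_on_comparison_test)
  show "(\<lambda>n. K\<^sup>2 * (cmod (\<psi> n))\<^sup>2) summable_on UNIV"
    by (intro summable_on_cmult_right assms)
  show "(cmod (d n * \<psi> n))\<^sup>2 \<le> K\<^sup>2 * (cmod (\<psi> n))\<^sup>2" for n
    using assms(2)[of n] by (simp add: norm_mult power_mult_distrib power_mono mult_right_mono)
qed simp

lemma ell2_cinner_aux:
  fixes \<phi> \<psi> :: "int \<Rightarrow> complex"
  assumes "(\<lambda>n. (cmod (\<phi> n))\<^sup>2) summable_on UNIV" "(\<lambda>n. (cmod (\<psi> n))\<^sup>2) summable_on UNIV"
  shows "(\<lambda>n. cnj (\<phi> n) * \<psi> n) summable_on UNIV"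
proof (rule abs_summable_summable, rule summable_on_comparison_test)
  show "(\<lambda>n. (cmod (\<phi> n))\<^sup>2 + (cmod (\<psi> n))\<^sup>2) summable_on UNIV"
    by (intro summable_on_add assms)
  fix n
  have "0 \<le> cmod (\<phi> n) * cmod (\<psi> n)" by simp
  then show "norm (cnj (\<phi> n) * \<psi> n) \<le> (cmod (\<phi> n))\<^sup>2 + (cmod (\<psi> n))\<^sup>2"
    using sum_squares_bound[of "cmod (\<phi> n)" "cmod (\<psi> n)"] unfolding norm_mult complex_mod_cnj
    by linarith
qed simp

lift_definition cinner_ell2 :: "ell2 \<Rightarrow> ell2 \<Rightarrow> complex" is
  "\<lambda>\<phi> \<psi>. \<Sum>\<^sub>\<infinity>n. cnj (\<phi> n) * \<psi> n" .

lift_definition scaleC_ell2 :: "complex \<Rightarrow> ell2 \<Rightarrow> ell2" is "\<lambda>z \<psi> n. z * \<psi> n"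
  by (rule ell2_mult_aux) auto

lift_definition delta0 :: ell2 is "\<lambda>n. if n = 0 then 1 else 0"
proof -
  have "(\<lambda>n::int. (cmod (if n = 0 then 1 else 0))\<^sup>2) summable_on {0}"
    by (rule summable_on_finite) simp
  then show "(\<lambda>n::int. (cmod (if n = 0 then 1 else 0))\<^sup>2) summable_on UNIV"
    by (rule summable_on_cong_neutral[THEN iffD1, rotated 3]) auto
qed

instantiation ell2 :: real_inner
begin

lift_definition zero_ell2 :: ell2 is "\<lambda>_. 0" by simp

lift_definition plus_ell2 :: "ell2 \<Rightarrow> ell2 \<Rightarrow> ell2" is "\<lambda>\<phi> \<psi> n. \<phi> n + \<psi> n"
  by (rule ell2_add_aux)

lift_definition uminus_ell2 :: "ell2 \<Rightarrow> ell2" is "\<lambda>\<psi> n. - \<psi> n" by simp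

definition minus_ell2 :: "ell2 \<Rightarrow> ell2 \<Rightarrow> ell2" where "minus_ell2 \<phi> \<psi> = \<phi> + (- \<psi>)"

definition scaleR_ell2 :: "real \<Rightarrow> ell2 \<Rightarrow> ell2" where
  "scaleR_ell2 r \<psi> = scaleC_ell2 (complex_of_real r) \<psi>"

definition inner_ell2 :: "ell2 \<Rightarrow> ell2 \<Rightarrow> real" where "inner_ell2 \<phi> \<psi> = Re (cinner_ell2 \<phi> \<psi>)"

definition norm_ell2 :: "ell2 \<Rightarrow> real" where
  "norm_ell2 \<psi> = sqrt (\<Sum>\<^sub>\<infinity>n. (cmod (ell2_fun \<psi> n))\<^sup>2)"

definition dist_ell2 :: "ell2 \<Rightarrow> ell2 \<Rightarrow> real" where "dist_ell2 \<phi> \<psi> = norm (\<phi> - \<psi>)"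

definition sgn_ell2 :: "ell2 \<Rightarrow> ell2" where "sgn_ell2 \<psi> = scaleR (inverse (norm \<psi>)) \<psi>"

definition uniformity_ell2 :: "(ell2 \<times> ell2) filter" where
  "uniformity_ell2 = (INF e\<in>{0 <..}. principal {(\<phi>, \<psi>). dist \<phi> \<psi> < e})"

definition open_ell2 :: "ell2 set \<Rightarrow> bool" where
  "open_ell2 U \<longleftrightarrow> (\<forall>\<phi>\<in>U. \<forall>\<^sub>F (\<phi>', \<psi>) in uniformity. \<phi>' = \<phi> \<longrightarrow> \<psi> \<in> U)"

instance
proof
  fix \<phi> \<psi> \<eta> :: ell2 and r s :: real
  have sq: "(\<lambda>n. (cmod (ell2_fun \<psi> n))\<^sup>2) summable_on UNIV" for \<psi>
    using ell2_fun[of \<psi>] by simp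
  have cs: "(\<lambda>n. cnj (ell2_fun \<phi> n) * ell2_fun \<psi> n) summable_on UNIV" for \<phi> \<psi>
    by (intro ell2_cinner_aux sq)
  have self: "cinner_ell2 \<psi> \<psi> = of_real (\<Sum>\<^sub>\<infinity>n. (cmod (ell2_fun \<psi> n))\<^sup>2)" for \<psi>
  proof -
    have "cinner_ell2 \<psi> \<psi> = (\<Sum>\<^sub>\<infinity>n. of_real ((cmod (ell2_fun \<psi> n))\<^sup>2))"
      unfolding cinner_ell2.rep_eq
      by (intro infsum_cong) (simp add: complex_norm_square mult.commute del: of_real_power)
    also have "\<dots> = of_real (\<Sum>\<^sub>\<infinity>n. (cmod (ell2_fun \<psi> n))\<^sup>2)"
      by (intro infsumI has_sum_of_real has_sum_infsum sq)
    finally show ?thesis .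
  qed
  show "\<phi> + \<psi> + \<eta> = \<phi> + (\<psi> + \<eta>)" by transfer (simp add: add.assoc)
  show "\<phi> + \<psi> = \<psi> + \<phi>" by transfer (simp add: add.commute)
  show "0 + \<phi> = \<phi>" by transfer simp
  show "- \<phi> + \<phi> = 0" by transfer simp
  show "\<phi> - \<psi> = \<phi> + - \<psi>" by (rule minus_ell2_def)
  show "scaleR r (\<phi> + \<psi>) = scaleR r \<phi> + scaleR r \<psi>"
    unfolding scaleR_ell2_def by transfer (simp add: algebra_simps)
  show "scaleR (r + s) \<phi> = scaleR r \<phi> + scaleR s \<phi>"
    unfolding scaleR_ell2_def by transfer (simp add: algebra_simps)
  show "scaleR r (scaleR s \<phi>) = scaleR (r * s) \<phi>"
    unfolding scaleR_ell2_def by transfer (simp add: algebra_simps)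
  show "scaleR 1 \<phi> = \<phi>" unfolding scaleR_ell2_def by transfer simp
  show "dist \<phi> \<psi> = norm (\<phi> - \<psi>)" by (rule dist_ell2_def)
  show "sgn \<phi> = scaleR (inverse (norm \<phi>)) \<phi>" by (rule sgn_ell2_def)
  show "uniformity = (INF e\<in>{0 <..}. principal {(x, y). dist (x::ell2) y < e})"
    by (rule uniformity_ell2_def)
  show "open U = (\<forall>x\<in>U. \<forall>\<^sub>F (x', y) in uniformity. x' = x \<longrightarrow> y \<in> U)" for U :: "ell2 set"
    by (rule open_ell2_def)
  show "inner \<phi> \<psi> = inner \<psi> \<phi>"
  proof -
    have "cinner_ell2 \<phi> \<psi> = cnj (cinner_ell2 \<psi> \<phi>)"
      unfolding cinner_ell2.rep_eq infsum_cnj[symmetric] by (simp add: mult.commute)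
    then show ?thesis by (simp add: inner_ell2_def)
  qed
  show "inner (\<phi> + \<psi>) \<eta> = inner \<phi> \<eta> + inner \<psi> \<eta>"
    unfolding inner_ell2_def cinner_ell2.rep_eq plus_ell2.rep_eq
    by (simp add: distrib_right infsum_add cs)
  show "inner (scaleR r \<phi>) \<psi> = r * inner \<phi> \<psi>"
    unfolding inner_ell2_def cinner_ell2.rep_eq scaleR_ell2_def scaleC_ell2.rep_eq
    by (simp add: mult.assoc infsum_cmult_right')
  show "0 \<le> inner \<phi> \<phi>"
    unfolding inner_ell2_def self by (simp add: infsum_nonneg)
  show "inner \<phi> \<phi> = 0 \<longleftrightarrow> \<phi> = 0"
  proof
    assume "inner \<phi> \<phi> = 0"
    then have "(cmod (ell2_fun \<phi> n))\<^sup>2 = 0" for n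
      unfolding inner_ell2_def self
      by (intro nonneg_infsum_le_0D[where A = UNIV and f = "\<lambda>n. (cmod (ell2_fun \<phi> n))\<^sup>2"])
         (auto simp: sq)
    then show "\<phi> = 0" by (intro ell2_fun_inject[THEN iffD1]) (auto simp: zero_ell2.rep_eq)
  next
    assume "\<phi> = 0"
    then show "inner \<phi> \<phi> = 0" unfolding inner_ell2_def self by (simp add: zero_ell2.rep_eq)
  qed
  show "norm \<phi> = sqrt (inner \<phi> \<phi>)"
    unfolding inner_ell2_def self norm_ell2_def by simp
qed

end

section \<open>Spectrum, functional calculus, and diagonal operators\<close>

text \<open>
  Elements of \<open>ell2 \<Rightarrow>\<^sub>L ell2\<close> are real-linear. For complex-linear \<open>A\<close> this makes no difference
  below, as a two-sided inverse of the complex-linear map \<open>A - z\<close> is again complex-linear.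
\<close>

definition op_spectrum :: "(ell2 \<Rightarrow>\<^sub>L ell2) \<Rightarrow> complex set" where
  "op_spectrum A = {z. \<not> (\<exists>B :: ell2 \<Rightarrow>\<^sub>L ell2. \<forall>\<psi>.
      blinfun_apply B (blinfun_apply A \<psi> - scaleC_ell2 z \<psi>) = \<psi> \<and>
      blinfun_apply A (blinfun_apply B \<psi>) - scaleC_ell2 z (blinfun_apply B \<psi>) = \<psi>)}"

definition op_poly :: "real poly \<Rightarrow> (ell2 \<Rightarrow>\<^sub>L ell2) \<Rightarrow> (ell2 \<Rightarrow>\<^sub>L ell2)" where
  "op_poly p A = (\<Sum>i\<le>degree p. coeff p i *\<^sub>R ((\<lambda>B. A o\<^sub>L B) ^^ i) id_blinfun)"

text \<open>
  Continuous functional calculus for a bounded self-adjoint \<open>A\<close>: the norm limit of \<open>p\<^sub>n(A)\<close> for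
  any polynomials \<open>p\<^sub>n\<close> converging to \<open>h\<close> uniformly on the spectrum of \<open>A\<close>.
\<close>

definition op_fun :: "(real \<Rightarrow> real) \<Rightarrow> (ell2 \<Rightarrow>\<^sub>L ell2) \<Rightarrow> (ell2 \<Rightarrow>\<^sub>L ell2)" where
  "op_fun h A = (THE B. \<forall>p :: nat \<Rightarrow> real poly.
      uniform_limit {E. complex_of_real E \<in> op_spectrum A} (\<lambda>n. poly (p n)) h sequentially \<longrightarrow>
      (\<lambda>n. op_poly (p n) A) \<longlonglongrightarrow> B)"

text \<open>
  Multiplication by a bounded function; the value is irrelevant when \<open>d\<close> is unbounded.
\<close>

definition diag_op :: "(int \<Rightarrow> real) \<Rightarrow> (ell2 \<Rightarrow>\<^sub>L ell2)" where
  "diag_op d = Blinfun (\<lambda>\<psi>. Abs_ell2 (\<lambda>n. complex_of_real (d n) * ell2_fun \<psi> n))"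

lemma ell2_fun_diag_op:
  assumes "bounded (range d)"
  shows "ell2_fun (blinfun_apply (diag_op d) \<psi>) n = complex_of_real (d n) * ell2_fun \<psi> n"
proof -
  from assms obtain K where K: "\<And>n. \<bar>d n\<bar> \<le> K" by (auto simp: bounded_iff)
  let ?D = "\<lambda>\<psi>. Abs_ell2 (\<lambda>n. complex_of_real (d n) * ell2_fun \<psi> n)"
  have sq: "(\<lambda>n. (cmod (ell2_fun \<psi> n))\<^sup>2) summable_on UNIV" for \<psi>
    using ell2_fun[of \<psi>] by simp
  have sD: "(\<lambda>n. (cmod (complex_of_real (d n) * ell2_fun \<psi> n))\<^sup>2) summable_on UNIV" for \<psi>
    by (rule ell2_mult_aux[OF sq, of _ K]) (simp add: K)
  have D: "ell2_fun (?D \<psi>) = (\<lambda>n. complex_of_real (d n) * ell2_fun \<psi> n)" for \<psi>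
    by (rule Abs_ell2_inverse) (simp add: sD)
  have "bounded_linear ?D"
  proof (rule bounded_linear_intro[where K = K])
    show "?D (\<phi> + \<psi>) = ?D \<phi> + ?D \<psi>" for \<phi> \<psi>
      by (intro ell2_fun_inject[THEN iffD1] ext)
         (subst D, unfold plus_ell2.rep_eq D, rule distrib_left)
    show "?D (r *\<^sub>R \<psi>) = r *\<^sub>R ?D \<psi>" for r \<psi>
      by (intro ell2_fun_inject[THEN iffD1] ext)
         (subst D, unfold scaleR_ell2_def scaleC_ell2.rep_eq D, rule mult.left_commute)
    show "norm (?D \<psi>) \<le> norm \<psi> * K" for \<psi>
    proof -
      have K0: "0 \<le> K" using K[of 0] by linarith
      have "(\<Sum>\<^sub>\<infinity>n. (cmod (ell2_fun (?D \<psi>) n))\<^sup>2) \<le> (\<Sum>\<^sub>\<infinity>n. K\<^sup>2 * (cmod (ell2_fun \<psi> n))\<^sup>2)"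
      proof (rule infsum_mono)
        show "(\<lambda>n. (cmod (ell2_fun (?D \<psi>) n))\<^sup>2) summable_on UNIV" unfolding D by (rule sD)
        show "(\<lambda>n. K\<^sup>2 * (cmod (ell2_fun \<psi> n))\<^sup>2) summable_on UNIV"
          by (intro summable_on_cmult_right sq)
        show "(cmod (ell2_fun (?D \<psi>) n))\<^sup>2 \<le> K\<^sup>2 * (cmod (ell2_fun \<psi> n))\<^sup>2" for n
          unfolding D norm_mult power_mult_distrib norm_of_real
          by (intro mult_right_mono power_mono K) auto
      qed
      also have "\<dots> = K\<^sup>2 * (\<Sum>\<^sub>\<infinity>n. (cmod (ell2_fun \<psi> n))\<^sup>2)"
        by (rule infsum_cmult_right')
      finally have "norm (?D \<psi>) \<le> sqrt (K\<^sup>2 * (\<Sum>\<^sub>\<infinity>n. (cmod (ell2_fun \<psi> n))\<^sup>2))"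
        unfolding norm_ell2_def by (rule real_sqrt_le_mono)
      then show ?thesis using K0 by (simp add: norm_ell2_def real_sqrt_mult mult.commute)
    qed
  qed
  then have "blinfun_apply (diag_op d) = ?D"
    unfolding diag_op_def by (rule bounded_linear_Blinfun_apply)
  then show ?thesis by (simp add: D)
qed

section \<open>Dynamical systems and diagonal operators over them\<close>

text \<open>
  A system \<open>(\<Omega>, T, \<mu>)\<close> consists of a set \<open>\<Omega>\<close> (with the subspace topology), a homeomorphism \<open>T\<close>
  of \<open>\<Omega>\<close>, and a measure \<open>\<mu>\<close> whose space is \<open>\<Omega>\<close>.
\<close>

definition iterZ :: "'w set \<Rightarrow> ('w \<Rightarrow> 'w) \<Rightarrow> int \<Rightarrow> 'w \<Rightarrow> 'w" where
  "iterZ \<Omega> T n = (if n \<ge> 0 then T ^^ nat n else inv_into \<Omega> T ^^ nat (- n))"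

definition diag_family :: "'w set \<Rightarrow> ('w \<Rightarrow> 'w) \<Rightarrow> ('w \<Rightarrow> real) \<Rightarrow> 'w \<Rightarrow> (ell2 \<Rightarrow>\<^sub>L ell2)" where
  "diag_family \<Omega> T q \<omega> = diag_op (\<lambda>n. q (iterZ \<Omega> T n \<omega>))"

definition as_spectrum :: "'w set \<Rightarrow> ('w \<Rightarrow> 'w) \<Rightarrow> 'w measure \<Rightarrow> ('w \<Rightarrow> real) \<Rightarrow> real set" where
  "as_spectrum \<Omega> T \<mu> q = (THE S. compact S \<and>
      (AE \<omega> in \<mu>. op_spectrum (diag_family \<Omega> T q \<omega>) = complex_of_real ` S))"

definition dos_measure :: "'w set \<Rightarrow> ('w \<Rightarrow> 'w) \<Rightarrow> 'w measure \<Rightarrow> ('w \<Rightarrow> real) \<Rightarrow> real measure" where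
  "dos_measure \<Omega> T \<mu> q = (THE \<kappa>. sets \<kappa> = sets borel \<and>
      (\<forall>h :: real \<Rightarrow> real. continuous_on UNIV h \<longrightarrow> integrable \<kappa> h \<and>
        complex_of_real (LINT E|\<kappa>. h E) =
          (LINT \<omega>|\<mu>. cinner_ell2 delta0 (blinfun_apply (op_fun h (diag_family \<Omega> T q \<omega>)) delta0))))"

definition ids :: "'w set \<Rightarrow> ('w \<Rightarrow> 'w) \<Rightarrow> 'w measure \<Rightarrow> ('w \<Rightarrow> real) \<Rightarrow> real \<Rightarrow> real" where
  "ids \<Omega> T \<mu> q E = measure (dos_measure \<Omega> T \<mu> q) {..E}"

section \<open>Suspension and Schwartzman group\<close>

definition quotient_topology :: "'a topology \<Rightarrow> ('a \<times> 'a) set \<Rightarrow> 'a set topology" where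
  "quotient_topology X r = topology (\<lambda>U. U \<subseteq> topspace X // r \<and>
      openin X {x \<in> topspace X. r `` {x} \<in> U})"

lemma openin_quotient_topology:
  "openin (quotient_topology X r) U \<longleftrightarrow>
     U \<subseteq> topspace X // r \<and> openin X {x \<in> topspace X. r `` {x} \<in> U}"
proof -
  have "istopology (\<lambda>U. U \<subseteq> topspace X // r \<and> openin X {x \<in> topspace X. r `` {x} \<in> U})"
    unfolding istopology_def
  proof (intro conjI allI impI)
    fix S T assume *: "S \<subseteq> topspace X // r \<and> openin X {x \<in> topspace X. r `` {x} \<in> S}"
      "T \<subseteq> topspace X // r \<and> openin X {x \<in> topspace X. r `` {x} \<in> T}"
    then show "S \<inter> T \<subseteq> topspace X // r" by blast
    have "{x \<in> topspace X. r `` {x} \<in> S \<inter> T} =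
        {x \<in> topspace X. r `` {x} \<in> S} \<inter> {x \<in> topspace X. r `` {x} \<in> T}" by blast
    then show "openin X {x \<in> topspace X. r `` {x} \<in> S \<inter> T}" using * by auto
  next
    fix \<K> assume *: "\<forall>K\<in>\<K>. K \<subseteq> topspace X // r \<and> openin X {x \<in> topspace X. r `` {x} \<in> K}"
    then show "\<Union> \<K> \<subseteq> topspace X // r" by blast
    have "{x \<in> topspace X. r `` {x} \<in> \<Union> \<K>} = (\<Union>K\<in>\<K>. {x \<in> topspace X. r `` {x} \<in> K})" by blast
    then show "openin X {x \<in> topspace X. r `` {x} \<in> \<Union> \<K>}" using * by auto
  qed
  then show ?thesis unfolding quotient_topology_def by (simp add: topology_inverse')
qed

lemma topspace_quotient_topology: "topspace (quotient_topology X r) = topspace X // r"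
proof
  have "{x \<in> topspace X. r `` {x} \<in> topspace X // r} = topspace X" by (auto intro: quotientI)
  then have "openin (quotient_topology X r) (topspace X // r)"
    by (simp add: openin_quotient_topology)
  then show "topspace X // r \<subseteq> topspace (quotient_topology X r)" by (rule openin_subset)
  show "topspace (quotient_topology X r) \<subseteq> topspace X // r"
    using openin_quotient_topology[of X r "topspace (quotient_topology X r)"] by simp
qed

lemma quotient_map_quotient_topology:
  "quotient_map X (quotient_topology X r) (\<lambda>x. r `` {x})"
  unfolding quotient_map_def topspace_quotient_topology openin_quotient_topology
  by (auto simp: quotient_def)

text \<open>The relation generated by \<open>(T\<^sup>n \<omega>, t) \<sim> (\<omega>, t + n)\<close>.\<close>

definition susp_rel :: "'w set \<Rightarrow> ('w \<Rightarrow> 'w) \<Rightarrow> (('w \<times> real) \<times> ('w \<times> real)) set" where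
  "susp_rel \<Omega> T = {((\<omega>, s), (\<omega>', t)). \<omega> \<in> \<Omega> \<and> \<omega>' \<in> \<Omega> \<and>
      (\<exists>n. \<omega>' = iterZ \<Omega> T n \<omega> \<and> s = t + real_of_int n)}"

definition suspension :: "'w::topological_space set \<Rightarrow> ('w \<Rightarrow> 'w) \<Rightarrow> ('w \<times> real) set topology" where
  "suspension \<Omega> T = quotient_topology (top_of_set (\<Omega> \<times> UNIV)) (susp_rel \<Omega> T)"

text \<open>The flow on classes: \<open>\<tau>\<^sup>s [\<omega>, t] = [\<omega>, s + t]\<close>.\<close>

definition susp_flow :: "real \<Rightarrow> ('w \<times> real) set \<Rightarrow> ('w \<times> real) set" where
  "susp_flow s x = (\<lambda>(\<omega>, t). (\<omega>, s + t)) ` x"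

lemma susp_flow_class:
  "susp_flow s (susp_rel \<Omega> T `` {(\<omega>, t)}) = susp_rel \<Omega> T `` {(\<omega>, s + t)}"
proof
  show "susp_flow s (susp_rel \<Omega> T `` {(\<omega>, t)}) \<subseteq> susp_rel \<Omega> T `` {(\<omega>, s + t)}"
    by (auto simp: susp_flow_def susp_rel_def)
  show "susp_rel \<Omega> T `` {(\<omega>, s + t)} \<subseteq> susp_flow s (susp_rel \<Omega> T `` {(\<omega>, t)})"
  proof
    fix p assume p: "p \<in> susp_rel \<Omega> T `` {(\<omega>, s + t)}"
    obtain \<omega>' u where pu: "p = (\<omega>', u)" by (cases p)
    have "(\<omega>', u - s) \<in> susp_rel \<Omega> T `` {(\<omega>, t)}"
      using p by (auto simp: pu susp_rel_def)
    then show "p \<in> susp_flow s (susp_rel \<Omega> T `` {(\<omega>, t)})"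
      unfolding susp_flow_def pu by (rule rev_image_eqI) simp
  qed
qed

text \<open>
  The Borel measure on the suspension with \<open>\<integral> f d\<nu> = \<integral>\<integral>\<^sub>0\<^sup>1 f [\<omega>, t] dt d\<mu>(\<omega>)\<close>, that is, the
  image of the product of \<open>\<mu>\<close> and Lebesgue measure on the unit interval.
\<close>

definition susp_measure ::
  "'w::topological_space set \<Rightarrow> ('w \<Rightarrow> 'w) \<Rightarrow> 'w measure \<Rightarrow> ('w \<times> real) set measure" where
  "susp_measure \<Omega> T \<mu> = distr (\<mu> \<Otimes>\<^sub>M restrict_space lborel {0..1})
      (sigma (topspace (suspension \<Omega> T)) {U. openin (suspension \<Omega> T) U})
      (\<lambda>p. susp_rel \<Omega> T `` {p})"

lemma nn_integral_susp_measure: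
  assumes "(\<lambda>p. susp_rel \<Omega> T `` {p}) \<in> \<mu> \<Otimes>\<^sub>M restrict_space lborel {0..1} \<rightarrow>\<^sub>M
      sigma (topspace (suspension \<Omega> T)) {U. openin (suspension \<Omega> T) U}"
    and "f \<in> borel_measurable (susp_measure \<Omega> T \<mu>)"
  shows "(\<integral>\<^sup>+x. f x \<partial>susp_measure \<Omega> T \<mu>) =
      (\<integral>\<^sup>+\<omega>. (\<integral>\<^sup>+t\<in>{0..1}. f (susp_rel \<Omega> T `` {(\<omega>, t)}) \<partial>lborel) \<partial>\<mu>)"
proof -
  interpret L: sigma_finite_measure "restrict_space lborel {0..1::real}"
    by (rule sigma_finite_measure_restrict_space) (auto intro: lborel.sigma_finite_measure_axioms)
  have f: "f \<in> borel_measurable (sigma (topspace (suspension \<Omega> T)) {U. openin (suspension \<Omega> T) U})"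
    using assms(2) unfolding susp_measure_def by simp
  have "(\<lambda>p. f (susp_rel \<Omega> T `` {p})) \<in> borel_measurable (\<mu> \<Otimes>\<^sub>M restrict_space lborel {0..1})"
    using measurable_compose[OF assms(1) f] .
  then show ?thesis
    unfolding susp_measure_def
    by (subst nn_integral_distr[OF assms(1)])
       (use f in \<open>auto simp: L.nn_integral_fst[symmetric] nn_integral_restrict_space\<close>)
qed

text \<open>The circle \<open>\<real>/\<int>\<close>.\<close>

definition circle_rel :: "(real \<times> real) set" where
  "circle_rel = {(s, t). s - t \<in> \<int>}"

definition circle :: "real set topology" where
  "circle = quotient_topology euclidean circle_rel"

text \<open>
  The almost sure asymptotic slope of \<open>\<phi>\<close> along orbits. Two lifts along the same orbit differ by an
  integer constant, so it does not matter which lift is taken.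
\<close>

definition asymp_slope ::
  "'w::topological_space set \<Rightarrow> ('w \<Rightarrow> 'w) \<Rightarrow> 'w measure \<Rightarrow> (('w \<times> real) set \<Rightarrow> real set) \<Rightarrow> real" where
  "asymp_slope \<Omega> T \<mu> \<phi> = (THE a. AE x in susp_measure \<Omega> T \<mu>.
      \<exists>g :: real \<Rightarrow> real. continuous_on UNIV g \<and>
        (\<forall>t. circle_rel `` {g t} = \<phi> (susp_flow t x)) \<and>
        ((\<lambda>t. g t / t) \<longlongrightarrow> a) at_top)"

definition schwartzman ::
  "'w::topological_space set \<Rightarrow> ('w \<Rightarrow> 'w) \<Rightarrow> 'w measure \<Rightarrow> real set" where
  "schwartzman \<Omega> T \<mu> = {asymp_slope \<Omega> T \<mu> \<phi> | \<phi>. continuous_map (suspension \<Omega> T) circle \<phi>}"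

definition schwartzman0 ::
  "'w::topological_space set \<Rightarrow> ('w \<Rightarrow> 'w) \<Rightarrow> 'w measure \<Rightarrow> real set" where
  "schwartzman0 \<Omega> T \<mu> = schwartzman \<Omega> T \<mu> \<inter> {0<..<1}"

section \<open>Gaps and labels\<close>

text \<open>
  Elements of \<open>C(\<Omega>, \<real>)\<close> are represented by functions on the ambient type that are continuous
  on \<open>\<Omega>\<close>; only their values on \<open>\<Omega>\<close> matter.
\<close>

definition OG_diag ::
  "'w::topological_space set \<Rightarrow> ('w \<Rightarrow> 'w) \<Rightarrow> 'w measure \<Rightarrow> real \<Rightarrow> ('w \<Rightarrow> real) set" where
  "OG_diag \<Omega> T \<mu> l = {q. continuous_on \<Omega> q \<and>
      (\<exists>I \<in> components (- as_spectrum \<Omega> T \<mu> q). bounded I \<and> (\<forall>E\<in>I. ids \<Omega> T \<mu> q E = l))}"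

definition DL :: "'w::topological_space set \<Rightarrow> ('w \<Rightarrow> 'w) \<Rightarrow> 'w measure \<Rightarrow> real set" where
  "DL \<Omega> T \<mu> = {l \<in> schwartzman0 \<Omega> T \<mu>. OG_diag \<Omega> T \<mu> l \<noteq> {}}"

section \<open>Full shifts\<close>

text \<open>
  The single-site distribution is a measure on the alphabet \<open>A\<close> itself (with the Borel sets of
  \<open>A\<close>), so that the space of the product measure is the full shift space. The topology on
  \<open>int \<Rightarrow> real\<close> is the product topology.
\<close>

definition full_shift_space :: "real set \<Rightarrow> (int \<Rightarrow> real) set" where
  "full_shift_space A = {\<omega>. \<forall>n. \<omega> n \<in> A}"

definition full_shift_map :: "(int \<Rightarrow> real) \<Rightarrow> (int \<Rightarrow> real)" where
  "full_shift_map \<omega> = (\<lambda>n. \<omega> (n + 1))"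

definition full_shift_measure :: "real measure \<Rightarrow> (int \<Rightarrow> real) measure" where
  "full_shift_measure \<mu>0 = (\<Pi>\<^sub>M n\<in>UNIV. \<mu>0)"

lemma space_full_shift_measure:
  "space (full_shift_measure \<mu>0) = full_shift_space (space \<mu>0)"
  by (auto simp: full_shift_measure_def full_shift_space_def space_PiM PiE_def)

lemma iterZ_full_shift:
  assumes "\<omega> \<in> full_shift_space A"
  shows "iterZ (full_shift_space A) full_shift_map n \<omega> = (\<lambda>k. \<omega> (k + n))"
proof -
  have inj: "inj_on full_shift_map (full_shift_space A)"
  proof (rule inj_onI)
    fix \<omega> \<eta> assume "full_shift_map \<omega> = full_shift_map \<eta>"
    then have "\<omega> ((k - 1) + 1) = \<eta> ((k - 1) + 1)" for k unfolding full_shift_map_def by meson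
    then show "\<omega> = \<eta>" by auto
  qed
  have inv: "inv_into (full_shift_space A) full_shift_map \<eta> = (\<lambda>k. \<eta> (k - 1))"
    if "\<eta> \<in> full_shift_space A" for \<eta>
    by (rule inv_into_f_eq[OF inj]) (use that in \<open>auto simp: full_shift_space_def full_shift_map_def\<close>)
  have pos: "(full_shift_map ^^ m) \<omega> = (\<lambda>k. \<omega> (k + int m))" for m
    by (induction m) (auto simp: full_shift_map_def algebra_simps)
  have neg: "(inv_into (full_shift_space A) full_shift_map ^^ m) \<omega> = (\<lambda>k. \<omega> (k - int m))" for m
  proof (induction m)
    case (Suc m)
    have "(\<lambda>k. \<omega> (k - int m)) \<in> full_shift_space A"
      using assms by (auto simp: full_shift_space_def)
    then show ?case by (simp add: Suc inv algebra_simps)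
  qed simp
  show ?thesis by (auto simp: iterZ_def pos neg)
qed

end

theory Submission
  imports Defs
begin

text \<open>For a diagonal operator everything is explicit. The almost sure spectrum of \<open>V\<^sub>q\<close> is the range
  \<open>q(\<Omega>)\<close>, because almost every sequence contains every finite pattern and therefore has a dense orbit
  (\<open>as_spectrum_eq_image\<close>), and the density of states measure is the distribution of \<open>q\<close>
  (\<open>dos_measure_eq_distr\<close>). If \<open>E\<close> lies in a gap, then \<open>{q \<le> E} = {q < E}\<close> is an open and closed subset of
  the compact space \<open>\<Omega>\<close>, so membership in it is decided by finitely many coordinates
  (\<open>sublevel_depends_on_window\<close>). Its measure is then a sum of products of factors \<open>\<beta>\<close> and \<open>1 - \<beta>\<close>,
  hence the value at \<open>\<beta>\<close> of a polynomial \<open>P\<close> with integer coefficients. Read at any other point of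
  \<open>[0,1]\<close>, the same formula is the probability of the same set for a different coin, so \<open>P\<close> maps
  \<open>[0,1]\<close> into itself (\<open>ids_gap_polynomial\<close>).

  As \<open>\<beta>\<close> is transcendental, a label \<open>p(\<beta>)\<close> with an integer polynomial \<open>p\<close> determines \<open>p\<close>. A
  polynomial that leaves \<open>[0,1]\<close> somewhere on \<open>[0,1]\<close> thus gives a label without gap
  (\<open>OG_diag_empty\<close>). It remains to find such a \<open>p\<close> with \<open>0 < p(\<beta>) < 1\<close> for which \<open>p(\<beta>)\<close> belongs to the
  Schwartzman group. The fractional part of \<open>2\<beta>\<close> does: take \<open>p(x) = 2x\<close> if \<open>\<beta> < 1/2\<close>, which is \<open>2\<close>
  at \<open>1\<close>, and \<open>p(x) = 2x - 1\<close> otherwise, which is \<open>-1\<close> at \<open>0\<close>.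

  Every \<open>u + v\<beta>\<close> with integers \<open>u, v\<close> is in the Schwartzman group
  (\<open>integer_combination_in_schwartzman\<close>): the integral of the integer-valued function
  \<open>u + v (1 - \<omega>\<^sub>0)\<close> along the suspension flow is well defined modulo 1 on the suspension, and its
  asymptotic slope is the space average by the strong law of large numbers, which is derived from
  Hoeffding's inequality and the Borel-Cantelli lemma (\<open>AE_frequency_tendsto\<close>).\<close>

section \<open>Diagonal operators on the square-summable sequences\<close>

lemma ell2_eqI: "(\<And>n. ell2_fun \<phi> n = ell2_fun \<psi> n) \<Longrightarrow> \<phi> = \<psi>"
  by (intro ell2_fun_inject[THEN iffD1] ext)

lemma ell2_norm_square: "(norm \<psi>)\<^sup>2 = (\<Sum>\<^sub>\<infinity>n. (cmod (ell2_fun \<psi> n))\<^sup>2)"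
  unfolding norm_ell2_def by (simp add: infsum_nonneg)

lemma ell2_fun_add: "ell2_fun (\<phi> + \<psi>) n = ell2_fun \<phi> n + ell2_fun \<psi> n"
  by (simp add: plus_ell2.rep_eq)

lemma ell2_fun_minus: "ell2_fun (\<phi> - \<psi>) n = ell2_fun \<phi> n - ell2_fun \<psi> n"
  unfolding minus_ell2_def plus_ell2.rep_eq uminus_ell2.rep_eq by (rule diff_conv_add_uminus[symmetric])

lemma ell2_fun_scaleC: "ell2_fun (scaleC_ell2 z \<psi>) n = z * ell2_fun \<psi> n"
  by (simp add: scaleC_ell2.rep_eq)

lemma ell2_fun_scaleR: "ell2_fun (r *\<^sub>R \<psi>) n = of_real r * ell2_fun \<psi> n"
  by (simp add: scaleR_ell2_def ell2_fun_scaleC)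

lemma ell2_norm_multiplier_le:
  assumes "\<And>n. ell2_fun \<phi> n = c n * ell2_fun \<psi> n" "\<And>n. cmod (c n) \<le> K"
  shows "norm \<phi> \<le> K * norm \<psi>"
proof -
  have sq: "(\<lambda>n. (cmod (ell2_fun \<psi> n))\<^sup>2) summable_on UNIV" for \<psi>
    using ell2_fun[of \<psi>] by simp
  have K: "0 \<le> K" using assms(2)[of 0] norm_ge_zero[of "c 0"] by linarith
  have "(norm \<phi>)\<^sup>2 \<le> (\<Sum>\<^sub>\<infinity>n. K\<^sup>2 * (cmod (ell2_fun \<psi> n))\<^sup>2)"
    unfolding ell2_norm_square
  proof (rule infsum_mono[OF sq])
    show "(\<lambda>n. K\<^sup>2 * (cmod (ell2_fun \<psi> n))\<^sup>2) summable_on UNIV"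
      by (intro summable_on_cmult_right sq)
    show "(cmod (ell2_fun \<phi> n))\<^sup>2 \<le> K\<^sup>2 * (cmod (ell2_fun \<psi> n))\<^sup>2" for n
      unfolding assms(1) norm_mult power_mult_distrib
      by (intro mult_right_mono power_mono assms(2)) auto
  qed
  also have "\<dots> = (K * norm \<psi>)\<^sup>2"
    by (simp add: infsum_cmult_right' power_mult_distrib ell2_norm_square)
  finally show ?thesis using K by (meson mult_nonneg_nonneg norm_ge_zero power2_le_imp_le)
qed

text \<open>
  A resolvent of a diagonal operator is again diagonal, but with complex entries, whereas \<open>diag_op\<close> only takes real ones.
\<close>

lemma ell2_multiplier_exists:
  assumes "\<And>n. cmod (c n) \<le> K"
  shows "\<exists>B :: ell2 \<Rightarrow>\<^sub>L ell2. \<forall>\<psi> n. ell2_fun (B \<psi>) n = c n * ell2_fun \<psi> n"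
proof -
  define D where "D \<psi> = Abs_ell2 (\<lambda>n. c n * ell2_fun \<psi> n)" for \<psi>
  have D: "ell2_fun (D \<psi>) n = c n * ell2_fun \<psi> n" for \<psi> n
  proof -
    have "(\<lambda>n. (cmod (c n * ell2_fun \<psi> n))\<^sup>2) summable_on UNIV"
      using ell2_mult_aux[OF _ assms, of "ell2_fun \<psi>"] ell2_fun[of \<psi>] by simp
    then show ?thesis unfolding D_def by (subst Abs_ell2_inverse) auto
  qed
  have "bounded_linear D"
  proof (rule bounded_linear_intro[where K = K])
    show "D (\<phi> + \<psi>) = D \<phi> + D \<psi>" for \<phi> \<psi>
      by (rule ell2_eqI) (simp add: D ell2_fun_add algebra_simps)
    show "D (r *\<^sub>R \<psi>) = r *\<^sub>R D \<psi>" for r \<psi>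
      by (rule ell2_eqI) (simp add: D ell2_fun_scaleR algebra_simps)
    show "norm (D \<psi>) \<le> norm \<psi> * K" for \<psi>
      using ell2_norm_multiplier_le[OF D assms] by (simp add: mult.commute)
  qed
  then have "blinfun_apply (Blinfun D) = D" by (rule bounded_linear_Blinfun_apply)
  then show ?thesis using D by metis
qed

lemma norm_diag_op_le:
  assumes "\<And>n. \<bar>d n\<bar> \<le> K"
  shows "norm (diag_op d) \<le> K"
proof (rule norm_blinfun_bound)
  show "0 \<le> K" using assms[of 0] by linarith
  have "bounded (range d)" using assms by (auto simp: bounded_iff)
  from ell2_norm_multiplier_le[OF ell2_fun_diag_op[OF this]] 
  show "norm (diag_op d \<psi>) \<le> K * norm \<psi>" for \<psi>
    using assms by simp
qed

lemma diag_op_diff: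
  assumes "bounded (range c)" "bounded (range d)"
  shows "diag_op c - diag_op d = diag_op (\<lambda>n. c n - d n)"
proof (intro blinfun_eqI ell2_eqI)
  have "bounded (range (\<lambda>n. c n - d n))"
    using assms by (rule bounded_minus_comp)
  then show "ell2_fun ((diag_op c - diag_op d) \<psi>) n = ell2_fun (diag_op (\<lambda>n. c n - d n) \<psi>) n" for \<psi> n
    by (simp add: ell2_fun_diag_op assms blinfun.diff_left ell2_fun_minus algebra_simps)
qed

lemma exists_unit_vector_at:
  "\<exists>\<psi> :: ell2. norm \<psi> = 1 \<and> (\<forall>k. ell2_fun \<psi> k = (if k = n then 1 else 0))"
proof -
  let ?f = "\<lambda>k. if k = n then 1 else 0 :: complex"
  have "((\<lambda>k. (cmod (?f k))\<^sup>2) has_sum 1) UNIV"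
  proof -
    have "((\<lambda>k. (cmod (?f k))\<^sup>2) has_sum (\<Sum>k\<in>{n}. (cmod (?f k))\<^sup>2)) {n}"
      by (rule has_sum_finite) simp
    then show ?thesis
      by (subst has_sum_cong_neutral[where T = "{n}"]) auto
  qed
  then have "ell2_fun (Abs_ell2 ?f) = ?f" "(\<Sum>\<^sub>\<infinity>k. (cmod (?f k))\<^sup>2) = 1"
    by (auto intro!: Abs_ell2_inverse infsumI simp: summable_on_def)
  then show ?thesis by (intro exI[of _ "Abs_ell2 ?f"]) (simp add: norm_ell2_def)
qed

text \<open>
  Off the closure of the range the reciprocals of the entries stay bounded and give an inverse. If
  \<open>x\<close> is a limit of entries, a bounded inverse \<open>B\<close> would satisfy \<open>1 \<le> \<parallel>B\<parallel> \<bar>d n - x\<bar>\<close> for all \<open>n\<close>, by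
  applying it to the unit vectors.
\<close>

lemma op_spectrum_diag_op:
  assumes d: "bounded (range d)"
  shows "op_spectrum (diag_op d) = complex_of_real ` closure (range d)"
proof (intro set_eqI iffI)
  let ?A = "diag_op d"
  fix z assume z: "z \<in> complex_of_real ` closure (range d)"
  then obtain x where x: "z = of_real x" "x \<in> closure (range d)" by auto
  show "z \<in> op_spectrum ?A"
  proof (rule ccontr)
    assume "z \<notin> op_spectrum ?A"
    then obtain B :: "ell2 \<Rightarrow>\<^sub>L ell2" where B: "\<And>\<psi>. B (?A \<psi> - scaleC_ell2 z \<psi>) = \<psi>"
      unfolding op_spectrum_def by auto
    have "1 \<le> norm B * \<bar>d n - x\<bar>" for n
    proof -
      obtain \<psi> :: ell2 where \<psi>: "norm \<psi> = 1" "\<And>k. ell2_fun \<psi> k = (if k = n then 1 else 0)"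
        using exists_unit_vector_at by blast
      \<comment> \<open>Only the entry at \<open>n\<close> of a multiplier matters when it is applied to the unit vector at \<open>n\<close>;
        zero elsewhere keeps it bounded by that entry.\<close>
      have "norm (?A \<psi> - scaleC_ell2 z \<psi>) \<le> \<bar>d n - x\<bar> * norm \<psi>"
      proof (rule ell2_norm_multiplier_le[where c = "\<lambda>k. if k = n then of_real (d n - x) else 0"])
        show "ell2_fun (?A \<psi> - scaleC_ell2 z \<psi>) k
            = (if k = n then of_real (d n - x) else 0) * ell2_fun \<psi> k" for k
          by (simp add: ell2_fun_minus ell2_fun_scaleC ell2_fun_diag_op[OF d] \<psi> x(1))
        show "cmod (if k = n then of_real (d n - x) else 0) \<le> \<bar>d n - x\<bar>" for k
          by (simp only: norm_of_real norm_zero split: if_split) simp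
      qed
      then have le: "norm (?A \<psi> - scaleC_ell2 z \<psi>) \<le> \<bar>d n - x\<bar>" by (simp add: \<psi>)
      have "1 = norm (B (?A \<psi> - scaleC_ell2 z \<psi>))" by (simp add: B \<psi>)
      also have "\<dots> \<le> norm B * norm (?A \<psi> - scaleC_ell2 z \<psi>)" by (rule norm_blinfun)
      also have "\<dots> \<le> norm B * \<bar>d n - x\<bar>" by (rule mult_left_mono[OF le]) simp
      finally show ?thesis .
    qed
    moreover obtain n where "\<bar>d n - x\<bar> < 1 / (norm B + 1)"
    proof -
      \<comment> \<open>The summand 1 avoids a division by the norm of \<open>B\<close>, which has not been shown to be positive.\<close>
      have "0 < 1 / (norm B + 1)"
        by (intro divide_pos_pos add_nonneg_pos) auto
      then show ?thesis
        using x(2) that unfolding closure_approachable by (fastforce simp: dist_real_def)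
    qed
    moreover have "norm B * \<bar>d n - x\<bar> < 1" if "\<bar>d n - x\<bar> < 1 / (norm B + 1)" for n
    proof -
      have p: "0 < norm B + 1" by (intro add_nonneg_pos) auto
      have "norm B * \<bar>d n - x\<bar> \<le> (norm B + 1) * \<bar>d n - x\<bar>"
        by (intro mult_right_mono) auto
      also have "\<dots> < 1" using that p by (simp add: field_simps)
      finally show ?thesis .
    qed
    ultimately show False by (meson not_less)
  qed
next
  let ?A = "diag_op d"
  fix z assume "z \<in> op_spectrum ?A"
  show "z \<in> complex_of_real ` closure (range d)"
  proof (rule ccontr)
    assume z: "z \<notin> complex_of_real ` closure (range d)"
    have "closed (complex_of_real ` closure (range d))"
      using d by (intro compact_imp_closed compact_continuous_image continuous_intros)
        (simp add: compact_closure)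
    then obtain e where e: "e > 0" "\<And>y. y \<in> complex_of_real ` closure (range d) \<Longrightarrow> e \<le> dist z y"
      using z by (metis separate_point_closed)
    have de: "e \<le> cmod (of_real (d n) - z)" for n
    proof -
      have "complex_of_real (d n) \<in> complex_of_real ` closure (range d)"
        by (intro imageI closure_subset[THEN subsetD]) auto
      from e(2)[OF this] show ?thesis by (simp add: dist_norm norm_minus_commute)
    qed
    have nz: "of_real (d n) - z \<noteq> 0" for n using de[of n] e(1) by auto
    have "cmod (inverse (of_real (d n) - z)) \<le> inverse e" for n
      using de[of n] e(1) by (simp add: norm_inverse le_imp_inverse_le)
    from ell2_multiplier_exists[of "\<lambda>n. inverse (of_real (d n) - z)", OF this] obtain B :: "ell2 \<Rightarrow>\<^sub>L ell2" where
      B: "\<And>\<psi> n. ell2_fun (B \<psi>) n = inverse (of_real (d n) - z) * ell2_fun \<psi> n" by blast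
    have "B (?A \<psi> - scaleC_ell2 z \<psi>) = \<psi> \<and> ?A (B \<psi>) - scaleC_ell2 z (B \<psi>) = \<psi>" for \<psi>
    proof (intro conjI ell2_eqI)
      fix n
      have "of_real (d n) * ell2_fun \<psi> n - z * ell2_fun \<psi> n = (of_real (d n) - z) * ell2_fun \<psi> n"
        by (simp add: algebra_simps)
      then show "ell2_fun (B (?A \<psi> - scaleC_ell2 z \<psi>)) n = ell2_fun \<psi> n"
        using nz[of n] by (simp add: B ell2_fun_minus ell2_fun_scaleC ell2_fun_diag_op[OF d])
      have "of_real (d n) * (inverse (of_real (d n) - z) * ell2_fun \<psi> n)
          - z * (inverse (of_real (d n) - z) * ell2_fun \<psi> n)
          = (of_real (d n) - z) * (inverse (of_real (d n) - z) * ell2_fun \<psi> n)"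
        by (simp add: algebra_simps)
      then show "ell2_fun (?A (B \<psi>) - scaleC_ell2 z (B \<psi>)) n = ell2_fun \<psi> n"
        using nz[of n] by (simp add: B ell2_fun_minus ell2_fun_scaleC ell2_fun_diag_op[OF d])
    qed
    then have "z \<notin> op_spectrum ?A" unfolding op_spectrum_def by blast
    with \<open>z \<in> op_spectrum ?A\<close> show False by simp
  qed
qed

lemma bounded_poly_comp:
  fixes d :: "'a \<Rightarrow> real"
  assumes "bounded (range d)"
  shows "bounded (range (\<lambda>n. poly p (d n)))"
proof -
  have "compact (poly p ` closure (range d))"
    using assms by (intro compact_continuous_image continuous_intros)
        (simp add: compact_closure)
  moreover have "range (\<lambda>n. poly p (d n)) \<subseteq> poly p ` closure (range d)"
    using closure_subset[of "range d"] by (intro image_subsetI imageI) auto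
  ultimately show ?thesis using bounded_subset compact_imp_bounded by blast
qed

lemma op_poly_diag_op:
  assumes d: "bounded (range d)"
  shows "op_poly p (diag_op d) = diag_op (\<lambda>n. poly p (d n))"
proof (intro blinfun_eqI ell2_eqI)
  fix \<psi> n
  have pow: "ell2_fun ((((\<lambda>B. diag_op d o\<^sub>L B) ^^ i) id_blinfun) \<psi>) n
      = of_real (d n ^ i) * ell2_fun \<psi> n" for i
    by (induction i) (simp_all add: ell2_fun_diag_op[OF d])
  have sum: "ell2_fun ((\<Sum>i\<le>N. coeff p i *\<^sub>R ((\<lambda>B. diag_op d o\<^sub>L B) ^^ i) id_blinfun) \<psi>) n
      = of_real (\<Sum>i\<le>N. coeff p i * d n ^ i) * ell2_fun \<psi> n" for N
    by (induction N) (simp_all add: blinfun.add_left blinfun.scaleR_left ell2_fun_add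
        ell2_fun_scaleR pow algebra_simps del: funpow.simps)
  show "ell2_fun (op_poly p (diag_op d) \<psi>) n = ell2_fun (diag_op (\<lambda>n. poly p (d n)) \<psi>) n"
    unfolding op_poly_def sum ell2_fun_diag_op[OF bounded_poly_comp[OF d]]
    by (simp add: poly_altdef)
qed

text \<open>
  Weierstrass approximation, in the form required by the definition of \<open>op_fun\<close>: without an
  approximating sequence every operator would satisfy the description there.
\<close>

lemma exists_poly_uniform_limit:
  fixes h :: "real \<Rightarrow> real"
  assumes "compact K" "continuous_on K h"
  shows "\<exists>p. uniform_limit K (\<lambda>n. poly (p n)) h sequentially"
proof -
  have "\<exists>q. \<forall>x\<in>K. \<bar>h x - poly q x\<bar> < inverse (real (Suc n))" for n
  proof -
    obtain g where g: "real_polynomial_function g" "\<And>x. x \<in> K \<Longrightarrow> \<bar>h x - g x\<bar> < inverse (real (Suc n))"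
      using Stone_Weierstrass_real_polynomial_function[OF assms, of "inverse (real (Suc n))"]
      by auto
    then obtain a m where a: "g = (\<lambda>x. \<Sum>i\<le>m. a i * x ^ i)"
      by (auto simp: real_polynomial_function_iff_sum)
    have "g = poly (\<Sum>i\<le>m. monom (a i) i)"
      by (auto simp: a poly_sum poly_monom)
    with g(2) show ?thesis by auto
  qed
  then obtain p where p: "\<And>n x. x \<in> K \<Longrightarrow> \<bar>h x - poly (p n) x\<bar> < inverse (real (Suc n))"
    by metis
  have "uniform_limit K (\<lambda>n. poly (p n)) h sequentially"
  proof (rule uniform_limitI)
    fix e :: real assume "e > 0"
    then obtain N where N: "inverse (real (Suc N)) < e" using reals_Archimedean by blast
    show "\<forall>\<^sub>F n in sequentially. \<forall>x\<in>K. dist (poly (p n) x) (h x) < e"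
    proof (rule eventually_sequentiallyI[of N], intro ballI)
      fix n x assume "N \<le> n" "x \<in> K"
      have "inverse (real (Suc n)) \<le> inverse (real (Suc N))"
        using \<open>N \<le> n\<close> by (intro le_imp_inverse_le) auto
      with p[OF \<open>x \<in> K\<close>, of n] N show "dist (poly (p n) x) (h x) < e"
        unfolding dist_real_def abs_minus_commute[of "poly (p n) x"] by linarith
    qed
  qed
  then show ?thesis by blast
qed

text \<open>
  Polynomials of a diagonal operator act entrywise, and uniform convergence on the spectrum bounds
  the entries of the difference uniformly, hence its norm.
\<close>

lemma op_fun_diag_op:
  assumes d: "bounded (range d)" and h: "continuous_on (closure (range d)) h"
  shows "op_fun h (diag_op d) = diag_op (\<lambda>n. h (d n))"
proof -
  let ?K = "closure (range d)"
  have K: "compact ?K" using d by (simp add: compact_closure)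
  have dK: "d n \<in> ?K" for n by (rule closure_subset[THEN subsetD]) simp
  have spec: "{E. complex_of_real E \<in> op_spectrum (diag_op d)} = ?K"
    by (auto simp: op_spectrum_diag_op[OF d])
  have bh: "bounded (range (\<lambda>n. h (d n)))"
    by (rule bounded_subset[OF compact_imp_bounded[OF compact_continuous_image[OF h K]]])
       (use dK in auto)
  have conv: "(\<lambda>n. op_poly (p n) (diag_op d)) \<longlonglongrightarrow> diag_op (\<lambda>n. h (d n))"
    if p: "uniform_limit ?K (\<lambda>n. poly (p n)) h sequentially" for p
  proof (rule metric_LIMSEQ_I)
    fix e :: real assume "e > 0"
    then obtain N where N: "\<And>m x. m \<ge> N \<Longrightarrow> x \<in> ?K \<Longrightarrow> dist (poly (p m) x) (h x) < e / 2"
      using uniform_limitD[OF p, of "e / 2"] by (auto simp: eventually_sequentially)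
    have "dist (op_poly (p m) (diag_op d)) (diag_op (\<lambda>n. h (d n))) < e" if "m \<ge> N" for m
    proof -
      have "norm (diag_op (\<lambda>n. poly (p m) (d n) - h (d n))) \<le> e / 2"
        by (rule norm_diag_op_le) (use N[OF that dK] in \<open>simp add: dist_real_def less_imp_le\<close>)
      then show ?thesis using \<open>e > 0\<close>
        by (simp add: op_poly_diag_op[OF d] dist_norm diag_op_diff[OF bounded_poly_comp[OF d] bh])
    qed
    then show "\<exists>N. \<forall>m\<ge>N. dist (op_poly (p m) (diag_op d)) (diag_op (\<lambda>n. h (d n))) < e" by blast
  qed
  obtain p where p: "uniform_limit ?K (\<lambda>n. poly (p n)) h sequentially"
    using exists_poly_uniform_limit[OF K h] by blast
  show ?thesis
    unfolding op_fun_def spec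
  proof (rule the_equality)
    fix B
    assume "\<forall>p. uniform_limit ?K (\<lambda>n. poly (p n)) h sequentially \<longrightarrow>
      (\<lambda>n. op_poly (p n) (diag_op d)) \<longlonglongrightarrow> B"
    with p have "(\<lambda>n. op_poly (p n) (diag_op d)) \<longlonglongrightarrow> B" by blast
    then show "B = diag_op (\<lambda>n. h (d n))" using conv[OF p] by (rule LIMSEQ_unique)
  qed (use conv in blast)
qed

lemma cinner_delta0_diag_op:
  assumes "bounded (range d)"
  shows "cinner_ell2 delta0 (diag_op d delta0) = of_real (d 0)"
proof -
  have "cinner_ell2 delta0 (diag_op d delta0)
      = (\<Sum>\<^sub>\<infinity>n. if n = (0::int) then complex_of_real (d n) else 0)"
    unfolding cinner_ell2.rep_eq ell2_fun_diag_op[OF assms] delta0.rep_eq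
    by (intro infsum_cong) auto
  also have "\<dots> = (\<Sum>\<^sub>\<infinity>n\<in>{0::int}. complex_of_real (d n))"
    by (rule infsum_cong_neutral) auto
  finally show ?thesis by simp
qed

section \<open>Product spaces, measures on the line, and integer polynomials\<close>

lemma tendsto_coordinatewise:
  fixes f :: "'c \<Rightarrow> 'a \<Rightarrow> 'b::topological_space"
  assumes "\<And>i. ((\<lambda>x. f x i) \<longlongrightarrow> l i) F"
  shows "(f \<longlongrightarrow> l) F"
proof -
  have "limitin (product_topology (\<lambda>_. euclidean) UNIV) f l F"
    unfolding limitin_componentwise using assms by simp
  then show ?thesis by (simp add: euclidean_product_topology)
qed

lemma tendsto_coordinate:
  fixes f :: "'c \<Rightarrow> 'a \<Rightarrow> 'b::topological_space"
  assumes "(f \<longlongrightarrow> l) F"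
  shows "((\<lambda>x. f x i) \<longlongrightarrow> l i) F"
proof -
  have "limitin (product_topology (\<lambda>_. euclidean) UNIV) f l F"
    using assms by (simp add: euclidean_product_topology)
  then show ?thesis unfolding limitin_componentwise by simp
qed

lemma compact_full_shift_space:
  assumes "compact A"
  shows "compact (full_shift_space A)"
proof -
  have "full_shift_space A = PiE UNIV (\<lambda>_. A)" by (auto simp: full_shift_space_def)
  then have "compactin (product_topology (\<lambda>_. euclidean) UNIV) (full_shift_space A)"
    using assms by (simp add: compactin_PiE)
  then show ?thesis by (simp add: euclidean_product_topology)
qed

text \<open>
  Testing with cosines and sines determines the characteristic function, so Levy's uniqueness
  theorem applies; testing with the constant 1 shows that \<open>\<kappa>\<close> is a probability measure.
\<close>

lemma real_measure_eqI_continuous: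
  fixes \<kappa> \<kappa>' :: "real measure"
  assumes "real_distribution \<kappa>'" "sets \<kappa> = sets borel"
    and int: "\<And>h :: real \<Rightarrow> real. continuous_on UNIV h \<Longrightarrow> integrable \<kappa> h"
    and eq: "\<And>h :: real \<Rightarrow> real. continuous_on UNIV h \<Longrightarrow> (LINT x|\<kappa>. h x) = (LINT x|\<kappa>'. h x)"
  shows "\<kappa> = \<kappa>'"
proof -
  interpret K': real_distribution \<kappa>' by fact
  have space: "space \<kappa> = UNIV" using sets_eq_imp_space_eq[OF assms(2)] by simp
  have one: "integrable \<kappa> (\<lambda>_. 1 :: real)" "(LINT x|\<kappa>. 1) = (LINT x|\<kappa>'. (1::real))"
    by (intro int eq continuous_intros)+
  have "finite_measure \<kappa>"
    using one(1) by (intro finite_measureI) (simp add: integrable_iff_bounded less_top)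
  then interpret K: finite_measure \<kappa> .
  have "measure \<kappa> UNIV = 1"
    using one(2) K'.prob_space by (simp add: space)
  then have "prob_space \<kappa>"
    by (intro prob_spaceI) (simp add: K.emeasure_eq_measure space)
  then interpret K: real_distribution \<kappa>
    by (intro real_distribution.intro real_distribution_axioms.intro) (simp_all add: assms(2))
  have re: "Re (char M t) = (LINT x|M. cos (t * x))"
    and im: "Im (char M t) = (LINT x|M. sin (t * x))" if "real_distribution M" for M t
  proof -
    interpret real_distribution M by fact
    have "integrable M (\<lambda>x. iexp (t * x))"
      by (rule integrable_iexp) auto
    then show "Re (char M t) = (LINT x|M. cos (t * x))" "Im (char M t) = (LINT x|M. sin (t * x))"
      unfolding char_def by (simp_all add: integral_Re[symmetric] integral_Im[symmetric] Re_exp Im_exp)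
  qed
  have "char \<kappa> t = char \<kappa>' t" for t
    unfolding complex_eq_iff
    by (auto simp: re im K.real_distribution_axioms K'.real_distribution_axioms
        intro!: eq continuous_intros)
  then show ?thesis
    by (intro Levy_uniqueness K.real_distribution_axioms K'.real_distribution_axioms) auto
qed

lemma integer_coeffs_prod:
  fixes f :: "'b \<Rightarrow> real poly"
  assumes "\<And>j i. j \<in> J \<Longrightarrow> coeff (f j) i \<in> \<int>"
  shows "coeff (\<Prod>j\<in>J. f j) i \<in> \<int>"
  using assms
  by (induction J arbitrary: i rule: infinite_finite_induct)
     (auto simp: coeff_mult intro!: Ints_sum Ints_mult)

section \<open>The Bernoulli shift on two symbols\<close>

locale bernoulli_shift =
  fixes \<beta> :: real and \<mu>0 :: "real measure"
  assumes beta: "0 < \<beta>" "\<beta> < 1"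
    and prob_mu0: "prob_space \<mu>0"
    and sets_mu0: "sets \<mu>0 = sets (restrict_space borel {0, 1})"
    and mu0_zero: "measure \<mu>0 {0} = \<beta>" and mu0_one: "measure \<mu>0 {1} = 1 - \<beta>"
begin

abbreviation \<Omega> :: "(int \<Rightarrow> real) set" where "\<Omega> \<equiv> full_shift_space {0, 1}"

abbreviation \<mu> :: "(int \<Rightarrow> real) measure" where "\<mu> \<equiv> full_shift_measure \<mu>0"

lemma space_mu0: "space \<mu>0 = {0, 1}"
  using sets_eq_imp_space_eq[OF sets_mu0] by (simp add: space_restrict_space)

lemma space_mu [simp]: "space \<mu> = \<Omega>"
  by (simp add: space_full_shift_measure space_mu0)

lemma mem_Omega: "\<omega> \<in> \<Omega> \<longleftrightarrow> (\<forall>n. \<omega> n = 0 \<or> \<omega> n = 1)"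
  by (auto simp: full_shift_space_def)

sublocale P: product_prob_space "\<lambda>_. \<mu>0" "UNIV :: int set"
  using prob_mu0 by (simp add: product_prob_spaceI)

sublocale prob_space \<mu>
  unfolding full_shift_measure_def by unfold_locales

lemma singleton_in_mu0: "x \<in> {0, 1} \<Longrightarrow> {x} \<in> sets \<mu>0"
  unfolding sets_mu0 by (simp add: sets_restrict_space_iff)

lemma borel_measurable_mu0: "f \<in> borel_measurable borel \<Longrightarrow> f \<in> borel_measurable \<mu>0"
  unfolding measurable_cong_sets[OF sets_mu0 refl] by (rule measurable_restrict_space1)

lemma coordinate_measurable_mu0 [measurable]: "(\<lambda>\<omega>. \<omega> i) \<in> \<mu> \<rightarrow>\<^sub>M \<mu>0"
  unfolding full_shift_measure_def by (rule measurable_component_singleton) simp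

lemma coordinate_measurable [measurable]: "(\<lambda>\<omega>. \<omega> i) \<in> borel_measurable \<mu>"
  using measurable_compose[OF coordinate_measurable_mu0 borel_measurable_mu0[of "\<lambda>x. x"]] by simp

lemma measurable_id_mu_restrict: "(\<lambda>\<omega>. \<omega>) \<in> \<mu> \<rightarrow>\<^sub>M restrict_space borel \<Omega>"
  using sets.sets_into_space
  by (intro measurable_restrict_space2 measurable_coordinatewise_then_product coordinate_measurable)
     auto

lemma continuous_imp_measurable:
  fixes q :: "(int \<Rightarrow> real) \<Rightarrow> 'b :: topological_space"
  assumes "continuous_on \<Omega> q"
  shows "q \<in> borel_measurable \<mu>"
  using measurable_compose[OF measurable_id_mu_restrict
      borel_measurable_continuous_on_restrict[OF assms]] .

lemma indep_coordinates: "indep_vars (\<lambda>_. \<mu>0) (\<lambda>i \<omega>. \<omega> i) UNIV"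
proof (subst indep_vars_iff_distr_eq_PiM)
  show "distr \<mu> (Pi\<^sub>M UNIV (\<lambda>_. \<mu>0)) (\<lambda>x. \<lambda>i\<in>UNIV. x i)
      = Pi\<^sub>M UNIV (\<lambda>i. distr \<mu> \<mu>0 (\<lambda>\<omega>. \<omega> i))"
    unfolding full_shift_measure_def
    by (simp add: distr_PiM_component[OF prob_mu0] distr_id2 restrict_UNIV)
qed auto

text \<open>
  The mass of the one-point set of a symbol. Symbols are real numbers, so the value at a number other
  than 0 and 1 is arbitrary.
\<close>

definition weight :: "real \<Rightarrow> real" where
  "weight x = (if x = 0 then \<beta> else 1 - \<beta>)"

lemma prob_cylinder:
  assumes "finite J" "\<And>j. j \<in> J \<Longrightarrow> y j \<in> {0, 1}"
  shows "{\<omega> \<in> \<Omega>. \<forall>j\<in>J. \<omega> j = y j} \<in> sets \<mu>"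
    and "prob {\<omega> \<in> \<Omega>. \<forall>j\<in>J. \<omega> j = y j} = (\<Prod>j\<in>J. weight (y j))"
proof -
  have eq: "{\<omega> \<in> \<Omega>. \<forall>j\<in>J. \<omega> j = y j} = prod_emb UNIV (\<lambda>_. \<mu>0) J (\<Pi>\<^sub>E j\<in>J. {y j})"
    by (auto simp: prod_emb_def space_mu0 full_shift_space_def PiE_iff)
  show "{\<omega> \<in> \<Omega>. \<forall>j\<in>J. \<omega> j = y j} \<in> sets \<mu>"
    unfolding eq full_shift_measure_def using assms by (intro sets_PiM_I) (auto intro: singleton_in_mu0)
  have "prob {\<omega> \<in> \<Omega>. \<forall>j\<in>J. \<omega> j = y j} = (\<Prod>j\<in>J. measure \<mu>0 {y j})"
    unfolding eq full_shift_measure_def using assms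
    by (intro P.measure_PiM_emb) (auto intro: singleton_in_mu0)
  also have "\<dots> = (\<Prod>j\<in>J. weight (y j))"
    using assms(2) by (intro prod.cong) (force simp: weight_def mu0_zero mu0_one)+
  finally show "prob {\<omega> \<in> \<Omega>. \<forall>j\<in>J. \<omega> j = y j} = (\<Prod>j\<in>J. weight (y j))" .
qed

lemma expectation_zero_indicator: "expectation (\<lambda>\<omega>. 1 - \<omega> i) = \<beta>"
proof -
  have "expectation (\<lambda>\<omega>. 1 - \<omega> i) = expectation (indicat_real {\<omega> \<in> \<Omega>. \<forall>j\<in>{i}. \<omega> j = 0})"
    by (intro Bochner_Integration.integral_cong) (auto simp: mem_Omega indicator_def)
  also have "\<dots> = \<beta>"
    using prob_cylinder[of "{i}" "\<lambda>_. 0"]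
    by (simp add: weight_def Int_absorb2 Collect_conj_eq Int_commute Int_left_absorb)
  finally show ?thesis .
qed

lemma distr_coordinate:
  assumes "f \<in> borel_measurable borel"
  shows "distr \<mu> borel (\<lambda>\<omega>. f (\<omega> i)) = distr \<mu>0 borel f"
proof -
  have "distr \<mu> borel (\<lambda>\<omega>. f (\<omega> i)) = distr (distr \<mu> \<mu>0 (\<lambda>\<omega>. \<omega> i)) borel f"
    using distr_distr[OF borel_measurable_mu0[OF assms] coordinate_measurable_mu0[of i]]
    by (simp add: comp_def)
  also have "distr \<mu> \<mu>0 (\<lambda>\<omega>. \<omega> i) = \<mu>0"
    unfolding full_shift_measure_def by (rule distr_PiM_component) (auto intro: prob_mu0)
  finally show ?thesis .
qed

text \<open>
  Hoeffding's inequality bounds the probability of a deviation by a geometric sequence, so the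
  Borel-Cantelli lemma applies.
\<close>

lemma AE_frequency_eventually_close:
  assumes e: "e > 0"
  shows "AE \<omega> in \<mu>. \<forall>\<^sub>F n in sequentially. \<bar>(\<Sum>k\<in>{0..<int n}. 1 - \<omega> k) / real n - \<beta>\<bar> < e"
proof -
  define A where "A n = {\<omega> \<in> \<Omega>. \<bar>(\<Sum>k\<in>{0..<int n}. 1 - \<omega> k) / real n - \<beta>\<bar> \<ge> e}" for n
  have A_sets: "A n \<in> sets \<mu>" for n
    unfolding A_def space_mu[symmetric] by measurable
  have bound: "prob (A n) \<le> 2 * exp (- 2 * e\<^sup>2) ^ n" for n
  proof (cases "n = 0")
    case True
    have "prob (A n) \<le> 1" by simp
    also have "1 \<le> 2 * exp (- 2 * e\<^sup>2) ^ n" using True by simp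
    finally show ?thesis .
  next
    case False
    interpret H: Hoeffding_ineq_iid \<mu> "{0..<int n}" "\<lambda>k \<omega>. 1 - \<omega> k" "\<lambda>\<omega>. 1 - \<omega> 0" 0 1 \<beta>
    proof unfold_locales
      show "indep_vars (\<lambda>_. borel) (\<lambda>k \<omega>. 1 - \<omega> k) {0..<int n}"
        by (rule indep_vars_compose2[OF indep_vars_subset[OF indep_coordinates]])
           (auto intro!: borel_measurable_mu0)
      show "distr \<mu> borel (\<lambda>\<omega>. 1 - \<omega> k) = distr \<mu> borel (\<lambda>\<omega>. 1 - \<omega> 0)" for k
        by (simp add: distr_coordinate[of "\<lambda>x. 1 - x"])
      show "AE \<omega> in \<mu>. 1 - \<omega> 0 \<in> {0..1}"
      proof (rule AE_I2)
        fix \<omega> assume "\<omega> \<in> space \<mu>"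
        then have "\<omega> 0 = 0 \<or> \<omega> 0 = 1" by (simp add: mem_Omega)
        then show "1 - \<omega> 0 \<in> {0..1}" by auto
      qed
      show "\<beta> \<equiv> expectation (\<lambda>\<omega>. 1 - \<omega> 0)" by (simp add: expectation_zero_indicator)
    qed auto
    have "prob (A n) \<le> 2 * exp (- 2 * real n * e\<^sup>2)"
      using H.Hoeffding_ineq_abs_ge'[of e] e False unfolding A_def by simp
    also have "exp (- 2 * real n * e\<^sup>2) = exp (- 2 * e\<^sup>2) ^ n"
      by (simp add: exp_of_nat_mult[symmetric] algebra_simps)
    finally show ?thesis .
  qed
  have "summable (\<lambda>n. prob (A n))"
  proof (rule summable_comparison_test)
    show "\<exists>N. \<forall>n\<ge>N. norm (prob (A n)) \<le> 2 * exp (- 2 * e\<^sup>2) ^ n" using bound by auto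
    show "summable (\<lambda>n. 2 * exp (- 2 * e\<^sup>2) ^ n)"
      using e by (intro summable_mult summable_geometric) simp
  qed
  from borel_cantelli_AE1[OF A_sets _ this]
  have "AE \<omega> in \<mu>. \<forall>\<^sub>F n in sequentially. \<omega> \<in> space \<mu> - A n"
    by (simp add: emeasure_eq_measure)
  then show ?thesis
    by (rule AE_mp, intro AE_I2 impI) (auto simp: A_def not_le elim: eventually_mono)
qed

lemma AE_frequency_tendsto:
  "AE \<omega> in \<mu>. (\<lambda>n. (\<Sum>k\<in>{0..<int n}. 1 - \<omega> k) / real n) \<longlonglongrightarrow> \<beta>"
proof -
  have "AE \<omega> in \<mu>. \<forall>m. \<forall>\<^sub>F n in sequentially.
      \<bar>(\<Sum>k\<in>{0..<int n}. 1 - \<omega> k) / real n - \<beta>\<bar> < inverse (real (Suc m))"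
    by (subst AE_all_countable) (auto intro!: AE_frequency_eventually_close)
  then show ?thesis
  proof (rule AE_mp, intro AE_I2 impI)
    fix \<omega> :: "int \<Rightarrow> real"
    assume *: "\<forall>m. \<forall>\<^sub>F n in sequentially.
      \<bar>(\<Sum>k\<in>{0..<int n}. 1 - \<omega> k) / real n - \<beta>\<bar> < inverse (real (Suc m))"
    show "(\<lambda>n. (\<Sum>k\<in>{0..<int n}. 1 - \<omega> k) / real n) \<longlonglongrightarrow> \<beta>"
    proof (rule tendstoI)
      fix e :: real assume "e > 0"
      then obtain m where "inverse (real (Suc m)) < e" using reals_Archimedean by blast
      then show "\<forall>\<^sub>F n in sequentially. dist ((\<Sum>k\<in>{0..<int n}. 1 - \<omega> k) / real n) \<beta> < e"
        using *[rule_format, of m] by (auto simp: dist_real_def elim!: eventually_mono)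
    qed
  qed
qed

text \<open>
  Cut a half-line into disjoint windows of the length of the pattern. The pattern appears
  in each of them independently with a probability bounded below by some \<open>p > 0\<close>, so the probability
  that the first \<open>n + 1\<close> windows all miss it is at most \<open>(1 - p)\<^sup>n\<^sup>+\<^sup>1\<close>.
\<close>

lemma AE_pattern_occurs:
  assumes w: "\<And>j. w j \<in> {0, 1}"
  shows "AE \<omega> in \<mu>. \<exists>n. \<forall>j\<in>{- int N..int N}. \<omega> (j + n) = w j"
proof -
  let ?L = "2 * int N + 1"
  define K where "K k = {?L * int k - int N..?L * int k + int N}" for k :: nat
  define Q where "Q k x \<longleftrightarrow> (\<forall>i\<in>K k. x i = w (i - ?L * int k))" for k and x :: "int \<Rightarrow> real"
  define F where "F k = {\<omega> \<in> space \<mu>. \<not> Q k (\<lambda>i\<in>K k. \<omega> i)}" for k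
  define p where "p = min \<beta> (1 - \<beta>) ^ card {- int N..int N}"
  have p: "0 < p" using beta unfolding p_def by (intro zero_less_power) simp
  have "disjoint_family_on K UNIV"
    unfolding disjoint_family_on_def
  proof (intro ballI impI)
    fix k l :: nat assume "k \<noteq> l"
    have "?L * int k + ?L \<le> ?L * int l" if "k < l" for k l :: nat
    proof -
      have "?L * (int k + 1) \<le> ?L * int l" using that by (intro mult_left_mono) auto
      then show ?thesis by (simp add: algebra_simps)
    qed
    from this[of k l] this[of l k] \<open>k \<noteq> l\<close> show "K k \<inter> K l = {}"
      by (cases "k < l") (auto simp: K_def)
  qed
  then have "indep_vars (\<lambda>k. PiM (K k) (\<lambda>_. \<mu>0)) (\<lambda>k \<omega>. \<lambda>i\<in>K k. \<omega> i) UNIV"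
    by (intro indep_vars_restrict[OF indep_coordinates]) auto
  then have indep: "indep_events F UNIV"
    unfolding F_def
  proof (rule indep_eventsI_indep_vars)
    fix k :: nat
    have "{x \<in> space (PiM (K k) (\<lambda>_. \<mu>0)). x i = w (i - ?L * int k)}
        \<in> sets (PiM (K k) (\<lambda>_. \<mu>0))" if "i \<in> K k" for i
    proof -
      have "(\<lambda>x. x i) -` {w (i - ?L * int k)} \<inter> space (PiM (K k) (\<lambda>_. \<mu>0))
          \<in> sets (PiM (K k) (\<lambda>_. \<mu>0))"
        using that w by (intro measurable_sets[OF measurable_component_singleton] singleton_in_mu0)
      then show ?thesis by (simp add: vimage_def Int_def conj_commute)
    qed
    then show "{x \<in> space (PiM (K k) (\<lambda>_. \<mu>0)). \<not> Q k x} \<in> sets (PiM (K k) (\<lambda>_. \<mu>0))"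
      unfolding Q_def by (intro sets.sets_Collect_neg sets.sets_Collect_finite_All) (auto simp: K_def)
  qed
  have probF: "prob (F k) \<le> 1 - p" for k
  proof -
    let ?C = "{\<omega> \<in> \<Omega>. \<forall>i\<in>K k. \<omega> i = w (i - ?L * int k)}"
    have C: "?C \<in> sets \<mu>" "prob ?C = (\<Prod>i\<in>K k. weight (w (i - ?L * int k)))"
      using prob_cylinder[of "K k" "\<lambda>i. w (i - ?L * int k)"] w by (auto simp: K_def)
    have "F k = space \<mu> - ?C" by (auto simp: F_def Q_def)
    then have "prob (F k) = 1 - prob ?C" using prob_compl[OF C(1)] by simp
    moreover have "p = (\<Prod>i\<in>K k. min \<beta> (1 - \<beta>))"
      by (simp add: p_def K_def)
    moreover have "(\<Prod>i\<in>K k. min \<beta> (1 - \<beta>)) \<le> (\<Prod>i\<in>K k. weight (w (i - ?L * int k)))"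
      using beta by (intro prod_mono) (auto simp: weight_def)
    ultimately show ?thesis using C(2) by simp
  qed
  have F_events: "F k \<in> events" for k
    using indep by (auto simp: indep_events_def)
  have "prob (\<Inter>k. F k) \<le> (1 - p) ^ Suc n" for n
  proof -
    have "prob (\<Inter>k. F k) \<le> prob (\<Inter>k\<in>{..n}. F k)"
      using F_events by (intro finite_measure_mono) auto
    also have "\<dots> = (\<Prod>k\<le>n. prob (F k))"
      using indep by (auto simp: indep_events_def)
    also have "\<dots> \<le> (\<Prod>k\<le>n. 1 - p)" by (intro prod_mono) (auto simp: probF)
    finally show ?thesis by simp
  qed
  moreover have "(\<lambda>n. (1 - p) ^ Suc n) \<longlonglongrightarrow> 0"
  proof -
    have "0 \<le> 1 - p" using probF[of 0] measure_nonneg order_trans by blast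
    then show ?thesis using p by (intro LIMSEQ_Suc LIMSEQ_power_zero) simp
  qed
  ultimately have "prob (\<Inter>k. F k) \<le> 0"
    by (intro LIMSEQ_le_const) auto
  then have "prob (\<Inter>k. F k) = 0" by (simp add: measure_le_0_iff)
  then have "AE \<omega> in \<mu>. \<omega> \<notin> (\<Inter>k. F k)"
    using F_events by (subst (asm) prob_eq_0) auto
  then show ?thesis
  proof (rule AE_mp, intro AE_I2 impI)
    fix \<omega> assume "\<omega> \<in> space \<mu>" "\<omega> \<notin> (\<Inter>k. F k)"
    then obtain k where k: "\<And>i. i \<in> K k \<Longrightarrow> \<omega> i = w (i - ?L * int k)"
      by (auto simp: F_def Q_def)
    have "\<omega> (j + ?L * int k) = w j" if "j \<in> {- int N..int N}" for j
      using k[of "j + ?L * int k"] that by (auto simp: K_def)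
    then show "\<exists>n. \<forall>j\<in>{- int N..int N}. \<omega> (j + n) = w j" by blast
  qed
qed

text \<open>
  A null set has to be discarded for every pattern. On a fixed window a pattern is the indicator of
  a finite set of positions, and there are only countably many of these.
\<close>

lemma AE_all_patterns_occur:
  "AE \<omega> in \<mu>. \<forall>\<eta>\<in>\<Omega>. \<forall>N. \<exists>n. \<forall>j\<in>{- int N..int N}. \<omega> (j + n) = \<eta> j"
proof -
  have "AE \<omega> in \<mu>. \<forall>S\<in>{S. finite S}. \<forall>N. \<exists>n. \<forall>j\<in>{- int N..int N}. \<omega> (j + n) = indicator S j"
  proof (subst AE_ball_countable, rule countable_Collect_finite, intro ballI)
    fix S :: "int set"
    show "AE \<omega> in \<mu>. \<forall>N. \<exists>n. \<forall>j\<in>{- int N..int N}. \<omega> (j + n) = indicator S j"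
      unfolding AE_all_countable by (intro allI AE_pattern_occurs) (simp add: indicator_def)
  qed
  then show ?thesis
  proof (rule AE_mp, intro AE_I2 impI ballI allI)
    fix \<omega> \<eta> :: "int \<Rightarrow> real" and N
    assume *: "\<forall>S\<in>{S. finite S}. \<forall>N. \<exists>n. \<forall>j\<in>{- int N..int N}. \<omega> (j + n) = indicator S j"
      and "\<eta> \<in> \<Omega>"
    let ?S = "{j \<in> {- int N..int N}. \<eta> j = 1}"
    have "finite ?S" by (rule finite_subset[of _ "{- int N..int N}"]) auto
    then obtain n where "\<forall>j\<in>{- int N..int N}. \<omega> (j + n) = indicator ?S j"
      using * by blast
    moreover have "indicator ?S j = \<eta> j" if "j \<in> {- int N..int N}" for j
      using \<open>\<eta> \<in> \<Omega>\<close> that by (auto simp: indicator_def mem_Omega)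
    ultimately show "\<exists>n. \<forall>j\<in>{- int N..int N}. \<omega> (j + n) = \<eta> j"
      by metis
  qed
qed

end

section \<open>Spectrum and density of states of diagonal operators over the shift\<close>

context bernoulli_shift
begin

lemma compact_Omega: "compact \<Omega>"
  by (intro compact_full_shift_space finite_imp_compact) simp

lemma shift_in_Omega: "\<omega> \<in> \<Omega> \<Longrightarrow> (\<lambda>k. \<omega> (k + n)) \<in> \<Omega>"
  by (simp add: full_shift_space_def)

lemma diag_family_eq:
  "\<omega> \<in> \<Omega> \<Longrightarrow> diag_family \<Omega> full_shift_map q \<omega> = diag_op (\<lambda>n. q (\<lambda>k. \<omega> (k + n)))"
  unfolding diag_family_def by (simp only: iterZ_full_shift)

lemma compact_image_Omega: "continuous_on \<Omega> q \<Longrightarrow> compact (q ` \<Omega>)"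
  using compact_Omega by (rule compact_continuous_image[rotated])

lemma range_orbit_subset: "\<omega> \<in> \<Omega> \<Longrightarrow> range (\<lambda>n. q (\<lambda>k. \<omega> (k + n))) \<subseteq> q ` \<Omega>"
  using shift_in_Omega by auto

lemma bounded_range_orbit:
  fixes q :: "_ \<Rightarrow> real"
  assumes "continuous_on \<Omega> q" "\<omega> \<in> \<Omega>"
  shows "bounded (range (\<lambda>n. q (\<lambda>k. \<omega> (k + n))))"
  using compact_imp_bounded[OF compact_image_Omega[OF assms(1)]] range_orbit_subset[OF assms(2)]
  by (rule bounded_subset)

text \<open>
  Shifts of \<open>\<omega>\<close> that agree with \<open>\<eta>\<close> on larger and larger windows converge to \<open>\<eta>\<close>, so \<open>q \<eta>\<close> is a
  limit of values of \<open>q\<close> along the orbit.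
\<close>

lemma AE_closure_orbit:
  fixes q :: "_ \<Rightarrow> real"
  assumes q: "continuous_on \<Omega> q"
  shows "AE \<omega> in \<mu>. closure (range (\<lambda>n. q (\<lambda>k. \<omega> (k + n)))) = q ` \<Omega>"
  using AE_all_patterns_occur
proof (rule AE_mp, intro AE_I2 impI)
  fix \<omega> assume "\<omega> \<in> space \<mu>"
  then have \<omega>: "\<omega> \<in> \<Omega>" by simp
  assume patterns: "\<forall>\<eta>\<in>\<Omega>. \<forall>N. \<exists>n. \<forall>j\<in>{- int N..int N}. \<omega> (j + n) = \<eta> j"
  show "closure (range (\<lambda>n. q (\<lambda>k. \<omega> (k + n)))) = q ` \<Omega>"
  proof
    show "closure (range (\<lambda>n. q (\<lambda>k. \<omega> (k + n)))) \<subseteq> q ` \<Omega>"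
      using range_orbit_subset[OF \<omega>] compact_imp_closed[OF compact_image_Omega[OF q]]
      by (rule closure_minimal)
    show "q ` \<Omega> \<subseteq> closure (range (\<lambda>n. q (\<lambda>k. \<omega> (k + n))))"
    proof (rule image_subsetI)
      fix \<eta> assume \<eta>: "\<eta> \<in> \<Omega>"
      obtain n where n: "\<And>N j. j \<in> {- int N..int N} \<Longrightarrow> \<omega> (j + n N) = \<eta> j"
        using patterns \<eta> by metis
      have "((\<lambda>N k. \<omega> (k + n N)) \<longlongrightarrow> \<eta>) sequentially"
      proof (rule tendsto_coordinatewise, rule tendsto_eventually, rule eventually_sequentiallyI)
        fix j N assume "nat \<bar>j\<bar> \<le> N"
        then show "\<omega> (j + n N) = \<eta> j" by (intro n) auto
      qed
      then have "((\<lambda>N. q (\<lambda>k. \<omega> (k + n N))) \<longlongrightarrow> q \<eta>) sequentially"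
        using \<eta> \<omega> shift_in_Omega by (intro continuous_on_tendsto_compose[OF q]) auto
      then show "q \<eta> \<in> closure (range (\<lambda>n. q (\<lambda>k. \<omega> (k + n))))"
        unfolding closure_sequential by (intro exI[of _ "\<lambda>N. q (\<lambda>k. \<omega> (k + n N))"]) auto
    qed
  qed
qed

lemma as_spectrum_eq_image:
  assumes q: "continuous_on \<Omega> q"
  shows "as_spectrum \<Omega> full_shift_map \<mu> q = q ` \<Omega>"
proof -
  have AE: "AE \<omega> in \<mu>. op_spectrum (diag_family \<Omega> full_shift_map q \<omega>) = complex_of_real ` q ` \<Omega>"
    using AE_closure_orbit[OF q]
    by (rule AE_mp)
       (auto intro!: AE_I2 simp: diag_family_eq op_spectrum_diag_op bounded_range_orbit[OF q])
  show ?thesis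
    unfolding as_spectrum_def
  proof (rule the_equality)
    fix S assume "compact S \<and>
      (AE \<omega> in \<mu>. op_spectrum (diag_family \<Omega> full_shift_map q \<omega>) = complex_of_real ` S)"
    then have "AE \<omega> in \<mu>. op_spectrum (diag_family \<Omega> full_shift_map q \<omega>) = complex_of_real ` S"
      by simp
    with AE have "AE \<omega> in \<mu>. complex_of_real ` q ` \<Omega> = complex_of_real ` S"
      by eventually_elim simp
    then have "complex_of_real ` q ` \<Omega> = complex_of_real ` S" by simp
    then show "S = q ` \<Omega>" by (simp add: inj_image_eq_iff inj_of_real)
  qed (use AE compact_image_Omega[OF q] in simp)
qed

text \<open>
  The entry of \<open>h(V\<^sub>\<omega>)\<close> at the origin is \<open>h (q \<omega>)\<close>, for every \<open>\<omega>\<close> and not only almost surely; this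
  spares any measurability question about the original integrand.
\<close>

lemma dos_measure_eq_distr:
  assumes q: "continuous_on \<Omega> q"
  shows "dos_measure \<Omega> full_shift_map \<mu> q = distr \<mu> borel q"
proof -
  note [measurable] = continuous_imp_measurable[OF q]
  have real_distr: "real_distribution (distr \<mu> borel q)"
    by (rule real_distribution_distr) simp
  have cont_comp: "continuous_on \<Omega> (\<lambda>\<omega>. h (q \<omega>))" if "continuous_on UNIV h" for h :: "real \<Rightarrow> real"
    using continuous_on_compose2[OF that q] by simp
  have int: "integrable \<mu> (\<lambda>\<omega>. h (q \<omega>))" if h: "continuous_on UNIV h" for h :: "real \<Rightarrow> real"
  proof -
    obtain B where "\<And>\<omega>. \<omega> \<in> \<Omega> \<Longrightarrow> norm (h (q \<omega>)) \<le> B"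
      using compact_imp_bounded[OF compact_image_Omega[OF cont_comp[OF h]]]
      by (auto simp: bounded_iff)
    then show ?thesis
      by (intro integrable_const_bound[of _ B] AE_I2 continuous_imp_measurable cont_comp h) simp
  qed
  have diag: "(LINT \<omega>|\<mu>. cinner_ell2 delta0 (op_fun h (diag_family \<Omega> full_shift_map q \<omega>) delta0))
      = complex_of_real (LINT E|distr \<mu> borel q. h E)" if h: "continuous_on UNIV h" for h
  proof -
    have "cinner_ell2 delta0 (op_fun h (diag_family \<Omega> full_shift_map q \<omega>) delta0)
        = complex_of_real (h (q \<omega>))" if \<omega>: "\<omega> \<in> \<Omega>" for \<omega>
    proof -
      have "bounded (range (\<lambda>n. h (q (\<lambda>k. \<omega> (k + n)))))"
        using bounded_range_orbit[OF cont_comp[OF h] \<omega>] .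
      moreover have "op_fun h (diag_family \<Omega> full_shift_map q \<omega>)
          = diag_op (\<lambda>n. h (q (\<lambda>k. \<omega> (k + n))))"
        unfolding diag_family_eq[OF \<omega>]
        by (rule op_fun_diag_op[OF bounded_range_orbit[OF q \<omega>]])
           (rule continuous_on_subset[OF h subset_UNIV])
      ultimately show ?thesis by (simp add: cinner_delta0_diag_op)
    qed
    then have "(LINT \<omega>|\<mu>. cinner_ell2 delta0 (op_fun h (diag_family \<Omega> full_shift_map q \<omega>) delta0))
        = (LINT \<omega>|\<mu>. complex_of_real (h (q \<omega>)))"
      by (intro Bochner_Integration.integral_cong) auto
    also have "\<dots> = complex_of_real (LINT E|distr \<mu> borel q. h E)"
      using borel_measurable_continuous_onI[OF h]
      by (subst integral_distr) (auto simp: integral_complex_of_real)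
    finally show ?thesis .
  qed
  show ?thesis
    unfolding dos_measure_def
  proof (rule the_equality)
    show "sets (distr \<mu> borel q) = sets borel \<and>
      (\<forall>h :: real \<Rightarrow> real. continuous_on UNIV h \<longrightarrow> integrable (distr \<mu> borel q) h \<and>
        complex_of_real (LINT E|distr \<mu> borel q. h E) =
          (LINT \<omega>|\<mu>. cinner_ell2 delta0 (op_fun h (diag_family \<Omega> full_shift_map q \<omega>) delta0)))"
      using int by (simp add: diag integrable_distr_eq borel_measurable_continuous_onI)
    fix \<kappa> :: "real measure"
    assume *: "sets \<kappa> = sets borel \<and>
      (\<forall>h :: real \<Rightarrow> real. continuous_on UNIV h \<longrightarrow> integrable \<kappa> h \<and>
        complex_of_real (LINT E|\<kappa>. h E) =
          (LINT \<omega>|\<mu>. cinner_ell2 delta0 (op_fun h (diag_family \<Omega> full_shift_map q \<omega>) delta0)))"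
    show "\<kappa> = distr \<mu> borel q"
    proof (rule real_measure_eqI_continuous[OF real_distr])
      fix h :: "real \<Rightarrow> real" assume h: "continuous_on UNIV h"
      show "integrable \<kappa> h" using * h by blast
      have "complex_of_real (LINT E|\<kappa>. h E) = complex_of_real (LINT E|distr \<mu> borel q. h E)"
        unfolding diag[OF h, symmetric] using * h by blast
      then show "(LINT E|\<kappa>. h E) = (LINT E|distr \<mu> borel q. h E)"
        by (simp only: of_real_eq_iff)
    qed (use * in blast)
  qed
qed

section \<open>Gap labels are values of integer polynomials that map the unit interval to itself\<close>

text \<open>
  Otherwise there are pairs \<open>\<omega>\<close>, \<open>\<eta>\<close> that agree on arbitrarily large windows with
  \<open>q \<omega> \<le> E \<le> q \<eta>\<close>. By compactness some subsequence of both converges to a common limit \<open>l\<close>, and then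
  \<open>q l = E\<close>, contrary to the choice of \<open>E\<close>.
\<close>

lemma sublevel_depends_on_window:
  fixes q :: "_ \<Rightarrow> real"
  assumes q: "continuous_on \<Omega> q" and E: "E \<notin> q ` \<Omega>"
  obtains N where "\<And>\<omega> \<eta>. \<omega> \<in> \<Omega> \<Longrightarrow> \<eta> \<in> \<Omega> \<Longrightarrow> \<forall>j\<in>{- int N..int N}. \<omega> j = \<eta> j
    \<Longrightarrow> q \<omega> \<le> E \<Longrightarrow> q \<eta> \<le> E"
proof (rule ccontr)
  assume "\<not> thesis"
  then have "\<exists>\<omega> \<eta>. \<omega> \<in> \<Omega> \<and> \<eta> \<in> \<Omega> \<and> (\<forall>j\<in>{- int N..int N}. \<omega> j = \<eta> j) \<and> q \<omega> \<le> E \<and> E \<le> q \<eta>" for N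
    using that[of N] by (meson linear)
  then obtain \<omega> \<eta> where *: "\<And>N. \<omega> N \<in> \<Omega>" "\<And>N. \<eta> N \<in> \<Omega>"
    "\<And>N j. j \<in> {- int N..int N} \<Longrightarrow> \<omega> N j = \<eta> N j" "\<And>N. q (\<omega> N) \<le> E" "\<And>N. E \<le> q (\<eta> N)"
    by metis
  obtain l r where l: "l \<in> \<Omega>" "strict_mono r" "(\<omega> \<circ> r) \<longlonglongrightarrow> l"
    using compact_imp_seq_compact[OF compact_Omega] *(1) unfolding seq_compact_def by metis
  have "(\<lambda>N. \<eta> (r N)) \<longlonglongrightarrow> l"
  proof (rule tendsto_coordinatewise)
    fix j
    have ev: "\<forall>\<^sub>F N in sequentially. (\<omega> \<circ> r) N j = \<eta> (r N) j"
    proof (rule eventually_sequentiallyI)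
      fix N assume "nat \<bar>j\<bar> \<le> N"
      then have "nat \<bar>j\<bar> \<le> r N" using seq_suble[OF l(2), of N] by simp
      then show "(\<omega> \<circ> r) N j = \<eta> (r N) j" unfolding comp_apply by (intro *(3)) auto
    qed
    show "(\<lambda>N. \<eta> (r N) j) \<longlonglongrightarrow> l j"
      by (rule Lim_transform_eventually[OF tendsto_coordinate[OF l(3)] ev])
  qed
  then have "(\<lambda>N. q (\<eta> (r N))) \<longlonglongrightarrow> q l"
    using l(1) *(2) by (intro continuous_on_tendsto_compose[OF q]) auto
  then have "E \<le> q l" by (rule LIMSEQ_le_const) (use *(5) in blast)
  moreover have "(\<lambda>N. q ((\<omega> \<circ> r) N)) \<longlonglongrightarrow> q l"
    using l(1) *(1) by (intro continuous_on_tendsto_compose[OF q l(3)]) auto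
  then have "q l \<le> E" by (rule LIMSEQ_le_const2) (use *(4) in auto)
  ultimately show False using E l(1) by auto
qed

text \<open>
  The sublevel set is a finite disjoint union of cylinders over a window \<open>J\<close>. Replacing \<open>\<beta>\<close> by an
  indeterminate in the product formula for their measures gives \<open>P\<close>. The upper bound holds because
  summing the products over all words on \<open>J\<close> gives \<open>(t + (1 - t))\<^bsup>card J\<^esup> = 1\<close>.
\<close>

lemma ids_gap_polynomial:
  assumes q: "continuous_on \<Omega> q" and E: "E \<notin> q ` \<Omega>"
  obtains P :: "real poly" where "\<And>i. coeff P i \<in> \<int>"
    and "\<And>t. t \<in> {0..1} \<Longrightarrow> poly P t \<in> {0..1}"
    and "ids \<Omega> full_shift_map \<mu> q E = poly P \<beta>"
proof -
  obtain N where N: "\<And>\<omega> \<eta>. \<omega> \<in> \<Omega> \<Longrightarrow> \<eta> \<in> \<Omega> \<Longrightarrow> \<forall>j\<in>{- int N..int N}. \<omega> j = \<eta> j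
    \<Longrightarrow> q \<omega> \<le> E \<Longrightarrow> q \<eta> \<le> E"
    by (rule sublevel_depends_on_window[OF q E]) blast
  define J where "J = {- int N..int N}"
  define cyl where "cyl x = {\<omega> \<in> \<Omega>. \<forall>j\<in>J. \<omega> j = x j}" for x
  define S where "S = {x \<in> J \<rightarrow>\<^sub>E {0, 1}. \<exists>\<omega>\<in>cyl x. q \<omega> \<le> E}"
  define f where "f y = (if y = 0 then [:0, 1:] else [:1, -1 :: real:])" for y :: real
  define P where "P = (\<Sum>x\<in>S. \<Prod>j\<in>J. f (x j))"
  have J: "finite J" by (simp add: J_def)
  have S: "S \<subseteq> J \<rightarrow>\<^sub>E {0, 1}" by (auto simp: S_def)
  have finPi: "finite (J \<rightarrow>\<^sub>E {0, 1 :: real})" using J by (intro finite_PiE) auto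
  have finS: "finite S" using finite_subset[OF S finPi] .
  have "{\<omega> \<in> \<Omega>. q \<omega> \<le> E} = (\<Union>x\<in>S. cyl x)"
  proof (intro equalityI subsetI)
    fix \<omega> assume \<omega>: "\<omega> \<in> {\<omega> \<in> \<Omega>. q \<omega> \<le> E}"
    then have "\<omega> \<in> cyl (restrict \<omega> J)" "restrict \<omega> J \<in> J \<rightarrow>\<^sub>E {0, 1}"
      by (auto simp: cyl_def full_shift_space_def)
    then have "restrict \<omega> J \<in> S" using \<omega> by (auto simp: S_def)
    with \<open>\<omega> \<in> cyl (restrict \<omega> J)\<close> show "\<omega> \<in> (\<Union>x\<in>S. cyl x)" by blast
  next
    fix \<omega> assume "\<omega> \<in> (\<Union>x\<in>S. cyl x)"
    then obtain x \<eta> where "\<omega> \<in> cyl x" "\<eta> \<in> cyl x" "q \<eta> \<le> E" by (auto simp: S_def)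
    then have "\<omega> \<in> \<Omega>" "q \<omega> \<le> E" using N[of \<eta> \<omega>] by (auto simp: cyl_def J_def)
    then show "\<omega> \<in> {\<omega> \<in> \<Omega>. q \<omega> \<le> E}" by simp
  qed
  moreover have "ids \<Omega> full_shift_map \<mu> q E = prob {\<omega> \<in> \<Omega>. q \<omega> \<le> E}"
    unfolding ids_def dos_measure_eq_distr[OF q]
    by (subst measure_distr) (auto intro!: arg_cong[where f = prob] continuous_imp_measurable q)
  ultimately have "ids \<Omega> full_shift_map \<mu> q E = prob (\<Union>x\<in>S. cyl x)" by simp
  also have "\<dots> = (\<Sum>x\<in>S. prob (cyl x))"
  proof (rule finite_measure_finite_Union[OF finS])
    have "cyl x \<in> events" if "x \<in> S" for x
      unfolding cyl_def using that S J by (intro prob_cylinder) auto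
    then show "cyl ` S \<subseteq> events" by blast
    show "disjoint_family_on cyl S"
      unfolding disjoint_family_on_def
    proof (intro ballI impI)
      fix x y assume "x \<in> S" "y \<in> S" "x \<noteq> y"
      then obtain j where "x j \<noteq> y j" by auto
      moreover have "j \<in> J" using \<open>x \<in> S\<close> \<open>y \<in> S\<close> S \<open>x j \<noteq> y j\<close> by (metis PiE_arb subsetD)
      ultimately show "cyl x \<inter> cyl y = {}" by (auto simp: cyl_def)
    qed
  qed
  also have "\<dots> = poly P \<beta>"
  proof -
    have "prob (cyl x) = poly (\<Prod>j\<in>J. f (x j)) \<beta>" if "x \<in> S" for x
    proof -
      have "prob (cyl x) = (\<Prod>j\<in>J. weight (x j))"
        unfolding cyl_def using that S J by (intro prob_cylinder) auto
      also have "\<dots> = poly (\<Prod>j\<in>J. f (x j)) \<beta>"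
        by (simp add: poly_prod weight_def f_def if_distrib[of "\<lambda>p. poly p _"] cong: if_cong)
      finally show ?thesis .
    qed
    then show ?thesis by (simp add: P_def poly_sum)
  qed
  finally have ids: "ids \<Omega> full_shift_map \<mu> q E = poly P \<beta>" .
  have coeffs: "coeff P i \<in> \<int>" for i
    unfolding P_def coeff_sum
    by (intro Ints_sum integer_coeffs_prod) (auto simp: f_def coeff_pCons split: nat.split)
  have bounds: "poly P t \<in> {0..1}" if t: "t \<in> {0..1}" for t
  proof -
    have nonneg: "0 \<le> (\<Prod>j\<in>J. poly (f (x j)) t)" for x
      using t by (intro prod_nonneg) (auto simp: f_def)
    have "poly P t = (\<Sum>x\<in>S. \<Prod>j\<in>J. poly (f (x j)) t)"
      by (simp add: P_def poly_sum poly_prod)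
    moreover have "0 \<le> (\<Sum>x\<in>S. \<Prod>j\<in>J. poly (f (x j)) t)" by (intro sum_nonneg nonneg)
    moreover have "(\<Sum>x\<in>S. \<Prod>j\<in>J. poly (f (x j)) t)
        \<le> (\<Sum>x\<in>J \<rightarrow>\<^sub>E {0, 1}. \<Prod>j\<in>J. poly (f (x j)) t)"
      using finPi S nonneg by (intro sum_mono2) auto
    moreover have "(\<Sum>x\<in>J \<rightarrow>\<^sub>E {0, 1}. \<Prod>j\<in>J. poly (f (x j)) t)
        = (\<Prod>j\<in>J. \<Sum>y\<in>{0, 1}. poly (f y) t)"
      using J by (intro prod_sum_PiE[symmetric]) auto
    moreover have "\<dots> = 1" by (simp add: f_def)
    ultimately show ?thesis by simp
  qed
  show thesis using that[OF coeffs bounds ids] .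
qed

lemma OG_diag_empty:
  assumes "\<not> algebraic \<beta>" and p: "\<And>i. coeff p i \<in> \<int>" and t: "t \<in> {0..1}" "poly p t \<notin> {0..1}"
  shows "OG_diag \<Omega> full_shift_map \<mu> (poly p \<beta>) = {}"
proof (rule ccontr)
  assume "OG_diag \<Omega> full_shift_map \<mu> (poly p \<beta>) \<noteq> {}"
  then obtain q I where q: "continuous_on \<Omega> q" and I: "I \<in> components (- q ` \<Omega>)"
    and ids: "\<forall>E\<in>I. ids \<Omega> full_shift_map \<mu> q E = poly p \<beta>"
    unfolding OG_diag_def using as_spectrum_eq_image by fastforce
  obtain E where "E \<in> I" "E \<notin> q ` \<Omega>"
    using in_components_nonempty[OF I] in_components_subset[OF I] by blast
  obtain P where P: "\<And>i. coeff P i \<in> \<int>" "\<And>t. t \<in> {0..1} \<Longrightarrow> poly P t \<in> {0..1}"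
    "ids \<Omega> full_shift_map \<mu> q E = poly P \<beta>"
    by (rule ids_gap_polynomial[OF q \<open>E \<notin> q ` \<Omega>\<close>]) blast
  have "poly (P - p) \<beta> = 0" using ids \<open>E \<in> I\<close> P(3) by simp
  moreover have "coeff (P - p) i \<in> \<int>" for i using P(1) p by simp
  ultimately have "P - p = 0" using assms(1) algebraicI by blast
  then have "P = p" by simp
  with P(2)[OF t(1)] t(2) show False by simp
qed

end

section \<open>Integrals of a function of the symbols along the suspension flow\<close>

text \<open>
  For an integer \<open>k\<close>, the difference \<open>ramp (t - k) - ramp (s - k)\<close> with \<open>s \<le> t\<close> is the length of the
  part of \<open>[s, t]\<close> that lies in \<open>[k, k + 1]\<close>.
\<close>

definition ramp :: "real \<Rightarrow> real" where
  "ramp x = min 1 (max 0 x)"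

lemma ramp_bounds: "0 \<le> ramp x" "ramp x \<le> 1"
  by (auto simp: ramp_def)

lemma ramp_of_int: "ramp (of_int k) = (if 0 < k then 1 else 0)"
proof (cases "0 < k")
  case True
  then have "1 \<le> real_of_int k" by linarith
  then show ?thesis using True by (simp add: ramp_def)
qed (simp add: ramp_def)

text \<open>
  The oriented integral of \<open>f (\<omega> \<lfloor>r\<rfloor>)\<close> over \<open>r\<close> from \<open>s\<close> to \<open>t\<close>. As a sum of ramps, restricted to the
  finitely many nonzero terms, it is visibly continuous in \<open>\<omega>\<close>, \<open>s\<close> and \<open>t\<close> together if \<open>f\<close> is continuous, and shifting
  \<open>\<omega>\<close> is a change of the summation index.
\<close>

definition orbit_integral :: "(real \<Rightarrow> real) \<Rightarrow> (int \<Rightarrow> real) \<Rightarrow> real \<Rightarrow> real \<Rightarrow> real" where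
  "orbit_integral f \<omega> s t = (\<Sum>k | ramp (t - of_int k) \<noteq> ramp (s - of_int k).
      f (\<omega> k) * (ramp (t - of_int k) - ramp (s - of_int k)))"

text \<open>
  The index set now no longer depends on \<open>s\<close> and \<open>t\<close>, which makes additivity and continuity
  statements about a fixed finite sum.
\<close>

lemma orbit_integral_window:
  assumes "\<bar>s\<bar> \<le> of_int N" "\<bar>t\<bar> \<le> of_int N"
  shows "orbit_integral f \<omega> s t =
    (\<Sum>k\<in>{-N..<N}. f (\<omega> k) * (ramp (t - of_int k) - ramp (s - of_int k)))"
  unfolding orbit_integral_def
proof (rule sum.mono_neutral_left)
  show "{k. ramp (t - of_int k) \<noteq> ramp (s - of_int k)} \<subseteq> {-N..<N}"
  proof safe
    fix k :: int assume ne: "ramp (t - of_int k) \<noteq> ramp (s - of_int k)"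
    have "\<not> k \<ge> N"
    proof
      assume "k \<ge> N"
      then have "real_of_int N \<le> of_int k" by simp
      with assms ne show False by (simp add: ramp_def)
    qed
    moreover have "\<not> k < - N"
    proof
      assume "k < - N"
      then have "real_of_int k + 1 \<le> - of_int N" by linarith
      with assms ne show False by (simp add: ramp_def)
    qed
    ultimately show "k \<in> {-N..<N}" by simp
  qed
qed auto

lemma common_int_bound:
  fixes x y :: real
  shows "\<exists>N. \<bar>x\<bar> \<le> of_int N \<and> \<bar>y\<bar> \<le> of_int N"
proof -
  have "max \<bar>x\<bar> \<bar>y\<bar> \<le> of_int \<lceil>max \<bar>x\<bar> \<bar>y\<bar>\<rceil>" by (rule le_of_int_ceiling)
  then show ?thesis by (intro exI[of _ "\<lceil>max \<bar>x\<bar> \<bar>y\<bar>\<rceil>"]) linarith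
qed

lemma orbit_integral_add:
  "orbit_integral f \<omega> r s + orbit_integral f \<omega> s t = orbit_integral f \<omega> r t"
proof -
  define N where "N = \<lceil>max \<bar>r\<bar> (max \<bar>s\<bar> \<bar>t\<bar>)\<rceil>"
  have "max \<bar>r\<bar> (max \<bar>s\<bar> \<bar>t\<bar>) \<le> of_int N" unfolding N_def by (rule le_of_int_ceiling)
  then have N: "\<bar>r\<bar> \<le> of_int N" "\<bar>s\<bar> \<le> of_int N" "\<bar>t\<bar> \<le> of_int N" by auto
  show ?thesis
    unfolding orbit_integral_window[OF N(1,2)] orbit_integral_window[OF N(2,3)]
      orbit_integral_window[OF N(1,3)] sum.distrib[symmetric]
    by (rule sum.cong) (simp_all add: algebra_simps)
qed

lemma orbit_integral_shift:
  "orbit_integral f (\<lambda>k. \<omega> (k + m)) s t = orbit_integral f \<omega> (s + of_int m) (t + of_int m)"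
  unfolding orbit_integral_def
  by (rule sum.reindex_bij_witness[of _ "\<lambda>k. k - m" "\<lambda>k. k + m"]) (auto simp: algebra_simps)

lemma orbit_integral_Ints:
  assumes "\<And>k. f (\<omega> k) \<in> \<int>"
  shows "orbit_integral f \<omega> (of_int m) (of_int n) \<in> \<int>"
  unfolding orbit_integral_def of_int_diff[symmetric] ramp_of_int
  using assms by (intro Ints_sum Ints_mult) auto

text \<open>
  An interval of length at most 1 overlaps at most two of the intervals between consecutive integers.
\<close>

lemma orbit_integral_bound:
  assumes f: "\<And>k. \<bar>f (\<omega> k)\<bar> \<le> C" and st: "s \<le> t" "t \<le> s + 1"
  shows "\<bar>orbit_integral f \<omega> s t\<bar> \<le> 2 * C"
proof -
  let ?S = "{k. ramp (t - of_int k) \<noteq> ramp (s - of_int k)}"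
  have S: "?S \<subseteq> {\<lfloor>s\<rfloor>..\<lfloor>s\<rfloor> + 1}"
  proof safe
    fix k :: int assume ne: "ramp (t - of_int k) \<noteq> ramp (s - of_int k)"
    have "\<not> k < \<lfloor>s\<rfloor>"
    proof
      assume "k < \<lfloor>s\<rfloor>"
      then have "of_int k + 1 \<le> s" by linarith
      with st ne show False by (simp add: ramp_def)
    qed
    moreover have "\<not> \<lfloor>s\<rfloor> + 1 < k"
    proof
      assume "\<lfloor>s\<rfloor> + 1 < k"
      then have "s + 1 \<le> of_int k" by linarith
      with st ne show False by (simp add: ramp_def)
    qed
    ultimately show "k \<in> {\<lfloor>s\<rfloor>..\<lfloor>s\<rfloor> + 1}" by simp
  qed
  have C: "0 \<le> C" using f[of 0] by linarith
  have "card ?S \<le> 2" using card_mono[OF _ S] by simp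
  have "\<bar>orbit_integral f \<omega> s t\<bar> \<le> (\<Sum>k\<in>?S. \<bar>f (\<omega> k) * (ramp (t - of_int k) - ramp (s - of_int k))\<bar>)"
    unfolding orbit_integral_def by (rule sum_abs)
  also have "\<dots> \<le> (\<Sum>k\<in>?S. C)"
  proof (rule sum_mono)
    fix k
    have "\<bar>ramp (t - of_int k) - ramp (s - of_int k)\<bar> \<le> 1"
      using ramp_bounds[of "t - of_int k"] ramp_bounds[of "s - of_int k"] by linarith
    from mult_mono[OF f this C] show "\<bar>f (\<omega> k) * (ramp (t - of_int k) - ramp (s - of_int k))\<bar> \<le> C"
      by (simp add: abs_mult)
  qed
  also have "\<dots> \<le> 2 * C"
    using \<open>card ?S \<le> 2\<close> C by (simp add: mult_right_mono)
  finally show ?thesis .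
qed

lemma orbit_integral_nat: "orbit_integral f \<omega> 0 (real n) = (\<Sum>k\<in>{0..<int n}. f (\<omega> k))"
proof -
  have diff: "real n - real_of_int k = of_int (int n - k)" "0 - real_of_int k = of_int (- k)" for k
    by simp_all
  have "{k. ramp (real n - of_int k) \<noteq> ramp (0 - of_int k)} = {0..<int n}"
    unfolding diff ramp_of_int by (auto split: if_splits)
  then show ?thesis
    unfolding orbit_integral_def unfolding diff ramp_of_int by (auto intro: sum.cong)
qed

lemma continuous_on_orbit_integral:
  assumes f: "continuous_on UNIV f"
  shows "continuous_on UNIV (\<lambda>(\<omega>, s, t). orbit_integral f \<omega> s t)"
proof -
  let ?U = "\<lambda>N. UNIV \<times> {- real_of_int N<..<of_int N} \<times> {- real_of_int N<..<of_int N} ::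
    ((int \<Rightarrow> real) \<times> real \<times> real) set"
  have "continuous_on (?U N) (\<lambda>(\<omega>, s, t). orbit_integral f \<omega> s t)" for N
  proof -
    let ?g = "\<lambda>p. \<Sum>k\<in>{-N..<N}. f (fst p k) *
      (ramp (snd (snd p) - of_int k) - ramp (fst (snd p) - of_int k))"
    have "continuous_on (?U N) (\<lambda>p. fst p k)" for k
      by (rule continuous_on_product_then_coordinatewise[OF continuous_on_fst[OF continuous_on_id]])
    then have coord: "continuous_on (?U N) (\<lambda>p. f (fst p k))" for k
      by (rule continuous_on_compose2[OF f]) simp
    have "continuous_on (?U N) ?g"
      unfolding ramp_def by (intro continuous_intros coord)
    then show ?thesis
      by (rule continuous_on_eq) (auto intro!: orbit_integral_window[symmetric])
  qed
  then have "continuous_on (\<Union>N. ?U N) (\<lambda>(\<omega>, s, t). orbit_integral f \<omega> s t)"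
    by (intro continuous_on_open_UN open_Times) auto
  moreover have "p \<in> (\<Union>N. ?U N)" for p
  proof -
    obtain N where N: "\<bar>fst (snd p)\<bar> \<le> of_int N" "\<bar>snd (snd p)\<bar> \<le> of_int N"
      using common_int_bound by blast
    then have "p \<in> ?U (N + 1)" by (cases p) auto
    then show ?thesis by blast
  qed
  then have "(\<Union>N. ?U N) = UNIV" by blast
  ultimately show ?thesis by simp
qed

lemma continuous_on_orbit_integral_compose:
  assumes "continuous_on UNIV f" "continuous_on S w" "continuous_on S a" "continuous_on S b"
  shows "continuous_on S (\<lambda>x. orbit_integral f (w x) (a x) (b x))"
proof -
  have "continuous_on S (\<lambda>x. (w x, a x, b x))"
    by (intro continuous_on_Pair assms)
  from continuous_on_compose2[OF continuous_on_orbit_integral[OF assms(1)] this] show ?thesis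
    by simp
qed

section \<open>Maps on the suspension and lifts of circle-valued maps\<close>

text \<open>
  The invariance hypothesis says that \<open>F\<close> is constant on the classes of the suspension relation, so
  that it descends to the quotient.
\<close>

lemma suspension_map_exists:
  assumes cont: "continuous_map (top_of_set (full_shift_space A \<times> UNIV)) Y F"
    and inv: "\<And>\<omega> m t. \<omega> \<in> full_shift_space A \<Longrightarrow> F (\<lambda>k. \<omega> (k + m), t) = F (\<omega>, t + of_int m)"
  obtains G where "continuous_map (suspension (full_shift_space A) full_shift_map) Y G"
    and "\<And>\<omega> t. \<omega> \<in> full_shift_space A
      \<Longrightarrow> G (susp_rel (full_shift_space A) full_shift_map `` {(\<omega>, t)}) = F (\<omega>, t)"
proof -
  let ?r = "susp_rel (full_shift_space A) full_shift_map"
  let ?X = "top_of_set (full_shift_space A \<times> (UNIV :: real set))"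
  have "F x = F y" if x: "x \<in> topspace ?X" and y: "y \<in> topspace ?X"
    and eq: "?r `` {x} = ?r `` {y}" for x y
  proof -
    obtain \<omega> s \<omega>' t where xy: "x = (\<omega>, s)" "y = (\<omega>', t)" by (cases x, cases y) auto
    have "(y, y) \<in> ?r"
      using y by (auto simp: xy susp_rel_def iterZ_def intro!: exI[of _ "0 :: int"])
    then have "(x, y) \<in> ?r" using eq by blast
    then obtain n where n: "\<omega> \<in> full_shift_space A" "s = t + of_int n"
      "\<omega>' = iterZ (full_shift_space A) full_shift_map n \<omega>"
      by (auto simp: xy susp_rel_def)
    then show ?thesis by (simp add: xy iterZ_full_shift inv)
  qed
  then obtain G where G: "continuous_map (suspension (full_shift_space A) full_shift_map) Y G"
    "\<And>x. x \<in> topspace ?X \<Longrightarrow> G (?r `` {x}) = F x"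
    using quotient_map_lift_exists[OF quotient_map_quotient_topology cont] unfolding suspension_def
    by metis
  show thesis by (rule that[OF G(1)]) (simp add: G(2))
qed

lemma circle_class_eq_iff: "circle_rel `` {x} = circle_rel `` {y} \<longleftrightarrow> x - y \<in> \<int>"
proof
  assume "circle_rel `` {x} = circle_rel `` {y}"
  moreover have "y \<in> circle_rel `` {y}" by (simp add: circle_rel_def)
  ultimately show "x - y \<in> \<int>" by (auto simp: circle_rel_def)
next
  assume xy: "x - y \<in> \<int>"
  have "x - z \<in> \<int> \<longleftrightarrow> y - z \<in> \<int>" for z
    using Ints_add[OF xy, of "y - z"] Ints_diff[OF _ xy, of "x - z"] by auto
  then show "circle_rel `` {x} = circle_rel `` {y}" by (auto simp: circle_rel_def)
qed

text \<open>
  The difference of the lifts is continuous and integer-valued on a connected set.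
\<close>

lemma lifts_differ_by_constant:
  fixes g h :: "real \<Rightarrow> real"
  assumes "continuous_on UNIV g" "continuous_on UNIV h"
    and "\<And>t. circle_rel `` {g t} = circle_rel `` {h t}"
  obtains c where "\<And>t. g t = h t + c"
proof -
  have ints: "g t - h t \<in> \<int>" for t using assms(3) by (simp add: circle_class_eq_iff)
  have "(\<lambda>t. g t - h t) constant_on UNIV"
  proof (rule continuous_discrete_range_constant)
    show "continuous_on UNIV (\<lambda>t. g t - h t)" by (intro continuous_intros assms)
    fix x
    have "1 \<le> norm ((g y - h y) - (g x - h x))" if "g y - h y \<noteq> g x - h x" for y
      using Ints_nonzero_abs_ge1[OF Ints_diff[OF ints[of y] ints[of x]]] that by simp
    then show "\<exists>e>0. \<forall>y. y \<in> UNIV \<and> g y - h y \<noteq> g x - h x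
        \<longrightarrow> e \<le> norm ((g y - h y) - (g x - h x))"
      by (intro exI[of _ 1]) auto
  qed auto
  then obtain c where "\<And>t. g t - h t = c" by (auto simp: constant_on_def)
  then have "g t = h t + c" for t by (metis add.commute diff_add_cancel)
  then show thesis by (rule that)
qed

lemma lift_slopes_eq:
  fixes g h :: "real \<Rightarrow> real"
  assumes "continuous_on UNIV g" "continuous_on UNIV h"
    and "\<And>t. circle_rel `` {g t} = circle_rel `` {h t}"
    and g: "((\<lambda>t. g t / t) \<longlongrightarrow> a) at_top" and h: "((\<lambda>t. h t / t) \<longlongrightarrow> b) at_top"
  shows "a = b"
proof -
  obtain c where c: "\<And>t. g t = h t + c"
    using lifts_differ_by_constant[OF assms(1-3)] by blast
  have "((\<lambda>t. h t / t + c / t) \<longlongrightarrow> b + 0) at_top"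
    by (intro tendsto_add h tendsto_divide_0[OF tendsto_const] filterlim_at_top_imp_at_infinity
        filterlim_ident)
  then have "((\<lambda>t. g t / t) \<longlongrightarrow> b) at_top" by (simp add: c add_divide_distrib)
  with g show ?thesis by (intro tendsto_unique[OF _ g]) auto
qed

text \<open>
  The bound on increments over unit intervals controls the error made by rounding the time down.
\<close>

lemma slope_from_integer_times:
  fixes g :: "real \<Rightarrow> real"
  assumes lim: "(\<lambda>n. (g (real n) - g 0) / real n) \<longlonglongrightarrow> a"
    and bound: "\<And>x y. x \<le> y \<Longrightarrow> y \<le> x + 1 \<Longrightarrow> \<bar>g y - g x\<bar> \<le> C"
  shows "((\<lambda>t. g t / t) \<longlongrightarrow> a) at_top"
proof -
  define n where "n t = nat \<lfloor>t\<rfloor>" for t :: real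
  define r where "r t = (g (real (n t)) - g 0) / real (n t)" for t
  have r: "(r \<longlongrightarrow> a) at_top"
    unfolding r_def n_def
    by (rule filterlim_compose[OF lim])
       (rule filterlim_compose[OF filterlim_nat_sequentially filterlim_floor_sequentially])
  have "\<forall>\<^sub>F t in at_top. \<bar>r t\<bar> < \<bar>a\<bar> + 1"
    by (rule order_tendstoD(2)[OF tendsto_rabs[OF r]]) simp
  then have "\<forall>\<^sub>F t in at_top. norm (g t / t - r t) \<le> (\<bar>a\<bar> + 1 + \<bar>g 0\<bar> + C) / t"
    using eventually_ge_at_top[of 1]
  proof eventually_elim
    case (elim t)
    have n: "real (n t) \<le> t" "t \<le> real (n t) + 1" "0 < real (n t)"
      using elim(2) unfolding n_def by linarith+
    have "g t - t * r t = (g t - g (real (n t))) + g 0 - (t - real (n t)) * r t"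
      using n by (simp add: r_def field_simps)
    also have "\<bar>\<dots>\<bar> \<le> \<bar>g t - g (real (n t))\<bar> + \<bar>g 0\<bar> + \<bar>(t - real (n t)) * r t\<bar>" by linarith
    also have "\<bar>(t - real (n t)) * r t\<bar> \<le> 1 * \<bar>r t\<bar>"
      unfolding abs_mult using n by (intro mult_right_mono) auto
    also have "\<bar>g t - g (real (n t))\<bar> + \<bar>g 0\<bar> + 1 * \<bar>r t\<bar> \<le> \<bar>a\<bar> + 1 + \<bar>g 0\<bar> + C"
      using bound[OF n(1,2)] elim(1) by linarith
    finally have "\<bar>g t - t * r t\<bar> \<le> \<bar>a\<bar> + 1 + \<bar>g 0\<bar> + C" by simp
    moreover have "g t / t - r t = (g t - t * r t) / t" using elim(2) by (simp add: field_simps)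
    ultimately show ?case using elim(2) by (simp add: divide_right_mono)
  qed
  moreover have "((\<lambda>t. (\<bar>a\<bar> + 1 + \<bar>g 0\<bar> + C) / t) \<longlongrightarrow> 0) at_top"
    by (intro tendsto_divide_0[OF tendsto_const] filterlim_at_top_imp_at_infinity filterlim_ident)
  ultimately have "((\<lambda>t. g t / t - r t) \<longlongrightarrow> 0) at_top" by (rule Lim_null_comparison)
  from tendsto_add[OF this r] show ?thesis by simp
qed

lemma continuous_map_imp_borel_measurable_sigma:
  fixes G :: "'a \<Rightarrow> 'b :: topological_space"
  assumes "continuous_map X euclidean G"
  shows "G \<in> borel_measurable (sigma (topspace X) {U. openin X U})"
proof (rule borel_measurableI)
  fix S :: "'b set" assume "open S"
  have sub: "{U. openin X U} \<subseteq> Pow (topspace X)" using openin_subset by auto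
  have "{x \<in> topspace X. G x \<in> S} \<in> sigma_sets (topspace X) {U. openin X U}"
    using \<open>open S\<close> openin_continuous_map_preimage[OF assms] by (intro sigma_sets.Basic) simp
  moreover have "G -` S \<inter> topspace X = {x \<in> topspace X. G x \<in> S}" by blast
  ultimately show "G -` S \<inter> space (sigma (topspace X) {U. openin X U})
      \<in> sets (sigma (topspace X) {U. openin X U})"
    using sub by (simp add: space_measure_of sets_measure_of)
qed

section \<open>Integer combinations of 1 and the weight belong to the Schwartzman group\<close>

context bernoulli_shift
begin

abbreviation class_of :: "(int \<Rightarrow> real) \<times> real \<Rightarrow> ((int \<Rightarrow> real) \<times> real) set" where
  "class_of p \<equiv> susp_rel \<Omega> full_shift_map `` {p}"

abbreviation X :: "((int \<Rightarrow> real) \<times> real) set topology" where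
  "X \<equiv> suspension \<Omega> full_shift_map"

abbreviation \<nu> :: "((int \<Rightarrow> real) \<times> real) set measure" where
  "\<nu> \<equiv> susp_measure \<Omega> full_shift_map \<mu>"

abbreviation unit_interval :: "real measure" where
  "unit_interval \<equiv> restrict_space lborel {0..1}"

lemma prob_space_unit_interval: "prob_space unit_interval"
  by (rule prob_space_restrict_space) auto

text \<open>
  An open set of the suspension pulls back to the trace on \<open>\<Omega> \<times> [0,1]\<close> of an open set, and open
  subsets of the second countable space \<open>(int \<Rightarrow> real) \<times> real\<close> are measurable for the product of the
  Borel algebras.
\<close>

lemma class_of_measurable:
  "class_of \<in> \<mu> \<Otimes>\<^sub>M unit_interval \<rightarrow>\<^sub>M sigma (topspace X) {U. openin X U}"
proof (rule measurable_measure_of)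
  show "{U. openin X U} \<subseteq> Pow (topspace X)" using openin_subset by auto
  have top: "topspace X = (\<Omega> \<times> UNIV) // susp_rel \<Omega> full_shift_map"
    by (simp add: suspension_def topspace_quotient_topology)
  show "class_of \<in> space (\<mu> \<Otimes>\<^sub>M unit_interval) \<rightarrow> topspace X"
    unfolding top by (auto simp: space_pair_measure intro!: quotientI)
  fix U assume "U \<in> {U. openin X U}"
  then obtain W where W: "open W" "{p \<in> \<Omega> \<times> UNIV. class_of p \<in> U} = (\<Omega> \<times> UNIV) \<inter> W"
    unfolding suspension_def openin_quotient_topology by (auto simp: openin_open)
  have "(\<lambda>p. (fst p, snd p)) \<in> \<mu> \<Otimes>\<^sub>M unit_interval \<rightarrow>\<^sub>M borel \<Otimes>\<^sub>M borel"
  proof (rule measurable_Pair)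
    have "(\<lambda>\<omega>. \<omega>) \<in> \<mu> \<rightarrow>\<^sub>M borel"
      by (rule continuous_imp_measurable) (rule continuous_on_id)
    then show "fst \<in> \<mu> \<Otimes>\<^sub>M unit_interval \<rightarrow>\<^sub>M borel"
      by (rule measurable_compose[OF measurable_fst])
    have "(\<lambda>t. t) \<in> unit_interval \<rightarrow>\<^sub>M borel" by (rule measurable_restrict_space1) simp
    then show "snd \<in> \<mu> \<Otimes>\<^sub>M unit_interval \<rightarrow>\<^sub>M borel"
      by (rule measurable_compose[OF measurable_snd])
  qed
  then have "(\<lambda>p. p) \<in> \<mu> \<Otimes>\<^sub>M unit_interval \<rightarrow>\<^sub>M borel" by (simp add: borel_prod)
  from measurable_sets[OF this, of W] W(1)
  have "W \<inter> space (\<mu> \<Otimes>\<^sub>M unit_interval) \<in> sets (\<mu> \<Otimes>\<^sub>M unit_interval)" by simp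
  moreover have "class_of -` U \<inter> space (\<mu> \<Otimes>\<^sub>M unit_interval) = W \<inter> space (\<mu> \<Otimes>\<^sub>M unit_interval)"
    using W(2) by (auto simp: space_pair_measure)
  ultimately show "class_of -` U \<inter> space (\<mu> \<Otimes>\<^sub>M unit_interval) \<in> sets (\<mu> \<Otimes>\<^sub>M unit_interval)"
    by simp
qed

lemma prob_space_nu: "prob_space \<nu>"
proof -
  interpret U: prob_space unit_interval by (rule prob_space_unit_interval)
  interpret pair_prob_space \<mu> unit_interval ..
  show ?thesis
    unfolding susp_measure_def by (intro prob_space_distr class_of_measurable)
qed

text \<open>
  As \<open>\<nu>\<close> is a probability measure, two candidates for the almost sure slope are realised at a common
  point, where any two lifts have the same slope.
\<close>

lemma asymp_slope_eqI:
  assumes "AE x in \<nu>. \<exists>g :: real \<Rightarrow> real. continuous_on UNIV g \<and>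
        (\<forall>t. circle_rel `` {g t} = \<phi> (susp_flow t x)) \<and> ((\<lambda>t. g t / t) \<longlongrightarrow> a) at_top"
    (is "AE x in _. ?P a x")
  shows "asymp_slope \<Omega> full_shift_map \<mu> \<phi> = a"
  unfolding asymp_slope_def
proof (rule the_equality)
  interpret N: prob_space \<nu> by (rule prob_space_nu)
  show "AE x in \<nu>. ?P a x" by fact
  fix b assume "AE x in \<nu>. ?P b x"
  with assms have "AE x in \<nu>. b = a"
  proof eventually_elim
    case (elim x)
    then show ?case by (elim exE conjE) (rule lift_slopes_eq, auto)
  qed
  then show "b = a" by simp
qed

text \<open>
  The circle-valued map is the class of \<open>orbit_integral f \<omega> 0 t\<close> modulo 1. Passing to another
  representative of \<open>[\<omega>, t]\<close> changes this integral by one over an interval with integer ends, which is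
  an integer because \<open>f\<close> takes integer values on the symbols. The almost sure statement about slopes
  needs a measurable set of points of the suspension; it is the convergence set of the time averages
  \<open>G n\<close> of \<open>f\<close> over \<open>[t, t + n]\<close>, which are continuous functions on the suspension.
\<close>

lemma integer_combination_in_schwartzman:
  fixes u v :: int
  shows "of_int u + of_int v * \<beta> \<in> schwartzman \<Omega> full_shift_map \<mu>"
proof -
  define f where "f x = of_int u + of_int v * (1 - x)" for x :: real
  define C where "C = \<bar>real_of_int u\<bar> + \<bar>real_of_int v\<bar>"
  let ?a = "of_int u + of_int v * \<beta> :: real"
  let ?I = "orbit_integral f"
  have f_cont: "continuous_on UNIV f" unfolding f_def by (intro continuous_intros)
  have f_vals: "f (\<omega> k) \<in> \<int>" "\<bar>f (\<omega> k)\<bar> \<le> C" if "\<omega> \<in> \<Omega>" for \<omega> k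
    using that unfolding mem_Omega f_def C_def by (cases "\<omega> k = 0"; auto)+
  obtain \<phi> where \<phi>: "continuous_map X circle \<phi>"
    "\<And>\<omega> t. \<omega> \<in> \<Omega> \<Longrightarrow> \<phi> (class_of (\<omega>, t)) = circle_rel `` {?I \<omega> 0 t}"
  proof (rule suspension_map_exists[where A = "{0, 1}" and Y = circle
        and F = "\<lambda>p. circle_rel `` {?I (fst p) 0 (snd p)}"])
    have "continuous_on (\<Omega> \<times> UNIV) (\<lambda>p. ?I (fst p) 0 (snd p))"
      by (intro continuous_on_orbit_integral_compose f_cont continuous_intros)
    then have I: "continuous_map (top_of_set (\<Omega> \<times> UNIV)) euclidean (\<lambda>p. ?I (fst p) 0 (snd p))"
      by simp
    have circle: "continuous_map euclidean circle (\<lambda>t. circle_rel `` {t})"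
      unfolding circle_def by (rule quotient_imp_continuous_map[OF quotient_map_quotient_topology])
    show "continuous_map (top_of_set (\<Omega> \<times> UNIV)) circle
        (\<lambda>p. circle_rel `` {?I (fst p) 0 (snd p)})"
      using continuous_map_compose[OF I circle] by (simp add: o_def)
    fix \<omega> m t assume "\<omega> \<in> \<Omega>"
    have "?I (\<lambda>k. \<omega> (k + m)) 0 t - ?I \<omega> 0 (t + of_int m) = - ?I \<omega> (of_int 0) (of_int m)"
      using orbit_integral_add[of f \<omega> 0 "of_int m" "t + of_int m"]
      by (simp add: orbit_integral_shift)
    also have "\<dots> \<in> \<int>"
      using f_vals(1)[OF \<open>\<omega> \<in> \<Omega>\<close>] by (intro Ints_minus orbit_integral_Ints)
    finally show "circle_rel `` {?I (fst (\<lambda>k. \<omega> (k + m), t)) 0 (snd (\<lambda>k. \<omega> (k + m), t))}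
        = circle_rel `` {?I (fst (\<omega>, t + of_int m)) 0 (snd (\<omega>, t + of_int m))}"
      by (simp add: circle_class_eq_iff)
  qed auto
  have "\<exists>G. continuous_map X euclideanreal G \<and>
      (\<forall>\<omega> t. \<omega> \<in> \<Omega> \<longrightarrow> G (class_of (\<omega>, t)) = ?I \<omega> t (t + real n) / real n)" for n
  proof (rule suspension_map_exists[where A = "{0, 1}" and Y = euclideanreal
        and F = "\<lambda>p. ?I (fst p) (snd p) (snd p + real n) * inverse (real n)"])
    have "continuous_on (\<Omega> \<times> UNIV) (\<lambda>p. ?I (fst p) (snd p) (snd p + real n) * inverse (real n))"
      by (intro continuous_on_orbit_integral_compose f_cont continuous_intros)
    then show "continuous_map (top_of_set (\<Omega> \<times> UNIV)) euclideanreal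
        (\<lambda>p. ?I (fst p) (snd p) (snd p + real n) * inverse (real n))" by simp
  qed (auto simp: orbit_integral_shift add.assoc add.commute[of "real n"] divide_inverse)
  then obtain G where G: "\<And>n. continuous_map X euclideanreal (G n)"
    "\<And>n \<omega> t. \<omega> \<in> \<Omega> \<Longrightarrow> G n (class_of (\<omega>, t)) = ?I \<omega> t (t + real n) / real n"
    by metis
  have [measurable]: "G n \<in> borel_measurable (sigma (topspace X) {U. openin X U})" for n
    by (rule continuous_map_imp_borel_measurable_sigma[OF G(1)])
  have average: "(\<lambda>n. G n (class_of (\<omega>, t))) \<longlonglongrightarrow> ?a"
    if freq: "(\<lambda>n. (\<Sum>k\<in>{0..<int n}. 1 - \<omega> k) / real n) \<longlonglongrightarrow> \<beta>"
      and \<omega>: "\<omega> \<in> \<Omega>" and t: "t \<in> {0..1}" for \<omega> t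
  proof -
    have "(\<lambda>n. of_int u + of_int v * ((\<Sum>k\<in>{0..<int n}. 1 - \<omega> k) / real n)) \<longlonglongrightarrow> ?a"
      by (intro tendsto_intros freq)
    \<comment> \<open>Replacing the interval \<open>[t, t + n]\<close> by \<open>[0, n]\<close> changes two pieces of length at most 1.\<close>
    moreover have "(\<lambda>n. (?I \<omega> (real n) (real n + t) - ?I \<omega> 0 t) / real n) \<longlonglongrightarrow> 0"
    proof (rule Lim_null_comparison)
      show "\<forall>\<^sub>F n in sequentially.
          norm ((?I \<omega> (real n) (real n + t) - ?I \<omega> 0 t) / real n) \<le> 4 * C / real n"
      proof (rule always_eventually, rule allI)
        fix n
        have "\<bar>?I \<omega> (real n) (real n + t)\<bar> \<le> 2 * C" "\<bar>?I \<omega> 0 t\<bar> \<le> 2 * C"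
          using t f_vals(2)[OF \<omega>] by (auto intro!: orbit_integral_bound)
        then show "norm ((?I \<omega> (real n) (real n + t) - ?I \<omega> 0 t) / real n) \<le> 4 * C / real n"
          by (auto simp: intro!: divide_right_mono)
      qed
      show "(\<lambda>n. 4 * C / real n) \<longlonglongrightarrow> 0" by (rule lim_const_over_n)
    qed
    ultimately have lim: "(\<lambda>n. of_int u + of_int v * ((\<Sum>k\<in>{0..<int n}. 1 - \<omega> k) / real n) +
        (?I \<omega> (real n) (real n + t) - ?I \<omega> 0 t) / real n) \<longlonglongrightarrow> ?a"
      using tendsto_add by fastforce
    have "of_int u + of_int v * ((\<Sum>k\<in>{0..<int n}. 1 - \<omega> k) / real n) +
        (?I \<omega> (real n) (real n + t) - ?I \<omega> 0 t) / real n = G n (class_of (\<omega>, t))"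
      if "n > 0" for n
    proof -
      have "?I \<omega> t (t + real n)
          = ?I \<omega> 0 (real n) + ?I \<omega> (real n) (real n + t) - ?I \<omega> 0 t"
        using orbit_integral_add[of f \<omega> 0 t "t + real n"]
          orbit_integral_add[of f \<omega> 0 "real n" "real n + t"] by (simp add: add.commute)
      moreover have "?I \<omega> 0 (real n) = real n * of_int u + of_int v * (\<Sum>k\<in>{0..<int n}. 1 - \<omega> k)"
        unfolding orbit_integral_nat f_def sum.distrib sum_distrib_left[symmetric] by simp
      ultimately have "G n (class_of (\<omega>, t)) = (real n * of_int u
          + of_int v * (\<Sum>k\<in>{0..<int n}. 1 - \<omega> k)
          + (?I \<omega> (real n) (real n + t) - ?I \<omega> 0 t)) / real n"
        by (simp add: G(2)[OF \<omega>])
      then show ?thesis using that by (simp add: add_divide_distrib)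
    qed
    with lim show ?thesis
      by (intro Lim_transform_eventually[OF lim] eventually_sequentiallyI[of 1]) auto
  qed
  have lift: "\<exists>g :: real \<Rightarrow> real. continuous_on UNIV g \<and>
      (\<forall>r. circle_rel `` {g r} = \<phi> (susp_flow r (class_of (\<omega>, t)))) \<and>
      ((\<lambda>r. g r / r) \<longlongrightarrow> ?a) at_top"
    if lim: "(\<lambda>n. G n (class_of (\<omega>, t))) \<longlonglongrightarrow> ?a" and \<omega>: "\<omega> \<in> \<Omega>" for \<omega> t
  proof (intro exI[of _ "\<lambda>r. ?I \<omega> 0 (r + t)"] conjI allI)
    show "continuous_on UNIV (\<lambda>r. ?I \<omega> 0 (r + t))"
      by (intro continuous_on_orbit_integral_compose f_cont continuous_intros)
    show "circle_rel `` {?I \<omega> 0 (r + t)} = \<phi> (susp_flow r (class_of (\<omega>, t)))" for r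
      by (simp add: susp_flow_class \<phi>(2)[OF \<omega>])
    have diff: "?I \<omega> 0 (y + t) - ?I \<omega> 0 (x + t) = ?I \<omega> (x + t) (y + t)" for x y
      using orbit_integral_add[of f \<omega> 0 "x + t" "y + t"] by simp
    show "((\<lambda>r. ?I \<omega> 0 (r + t) / r) \<longlongrightarrow> ?a) at_top"
    proof (rule slope_from_integer_times)
      show "(\<lambda>n. (?I \<omega> 0 (real n + t) - ?I \<omega> 0 (0 + t)) / real n) \<longlonglongrightarrow> ?a"
        using lim unfolding diff G(2)[OF \<omega>] by (simp add: add.commute)
      show "\<bar>?I \<omega> 0 (y + t) - ?I \<omega> 0 (x + t)\<bar> \<le> 2 * C" if "x \<le> y" "y \<le> x + 1" for x y
        unfolding diff using that f_vals(2)[OF \<omega>] by (intro orbit_integral_bound) auto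
    qed
  qed
  interpret U: prob_space unit_interval by (rule prob_space_unit_interval)
  interpret UP: pair_sigma_finite \<mu> unit_interval ..
  have "AE p in \<mu> \<Otimes>\<^sub>M unit_interval. (\<lambda>n. G n (class_of p)) \<longlonglongrightarrow> ?a"
  proof (rule UP.AE_pair_measure)
    note [measurable] = class_of_measurable
    show "{p \<in> space (\<mu> \<Otimes>\<^sub>M unit_interval). (\<lambda>n. G n (class_of p)) \<longlonglongrightarrow> ?a}
        \<in> sets (\<mu> \<Otimes>\<^sub>M unit_interval)"
      by measurable
    show "AE \<omega> in \<mu>. AE t in unit_interval. (\<lambda>n. G n (class_of (\<omega>, t))) \<longlonglongrightarrow> ?a"
      using AE_frequency_tendsto by (rule AE_mp) (auto intro!: AE_I2 average)
  qed
  then have "AE x in \<nu>. (\<lambda>n. G n x) \<longlonglongrightarrow> ?a"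
    unfolding susp_measure_def
    by (subst AE_distr_iff[OF class_of_measurable]) measurable
  then have "AE x in \<nu>. \<exists>g :: real \<Rightarrow> real. continuous_on UNIV g \<and>
      (\<forall>r. circle_rel `` {g r} = \<phi> (susp_flow r x)) \<and> ((\<lambda>r. g r / r) \<longlongrightarrow> ?a) at_top"
  proof (rule AE_mp, intro AE_I2 impI)
    fix x assume "x \<in> space \<nu>"
    then have "x \<in> topspace X"
      unfolding susp_measure_def using openin_subset[of X] by (auto simp: space_measure_of_conv)
    then obtain \<omega> t where x: "x = class_of (\<omega>, t)" "\<omega> \<in> \<Omega>"
      by (auto simp: suspension_def topspace_quotient_topology elim!: quotientE)
    assume "(\<lambda>n. G n x) \<longlonglongrightarrow> ?a"
    then show "\<exists>g :: real \<Rightarrow> real. continuous_on UNIV g \<and>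
      (\<forall>r. circle_rel `` {g r} = \<phi> (susp_flow r x)) \<and> ((\<lambda>r. g r / r) \<longlongrightarrow> ?a) at_top"
      unfolding x(1) by (rule lift[OF _ x(2)])
  qed
  then have "asymp_slope \<Omega> full_shift_map \<mu> \<phi> = ?a" by (rule asymp_slope_eqI)
  with \<phi>(1) show ?thesis unfolding schwartzman_def by (intro CollectI exI[of _ \<phi>]) simp
qed

end

section \<open>A label without gap\<close>

theorem theorem1p9:
  fixes \<beta> :: real
    and \<mu>0 :: "real measure"
    and \<Omega> :: "(int \<Rightarrow> real) set"
    and T :: "(int \<Rightarrow> real) \<Rightarrow> (int \<Rightarrow> real)"
    and \<mu> :: "(int \<Rightarrow> real) measure"
  assumes "0 < \<beta>" and "\<beta> < 1" and "\<not> algebraic \<beta>"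
    and "prob_space \<mu>0"
    and "sets \<mu>0 = sets (restrict_space borel {0, 1})"
    and "measure \<mu>0 {0} = \<beta>" and "measure \<mu>0 {1} = 1 - \<beta>"
    and "\<Omega> = full_shift_space {0, 1}"
    and "T = full_shift_map"
    and "\<mu> = full_shift_measure \<mu>0"
  shows "(\<exists>l \<in> schwartzman0 \<Omega> T \<mu>. OG_diag \<Omega> T \<mu> l = {}) \<and> DL \<Omega> T \<mu> \<subset> schwartzman0 \<Omega> T \<mu>"
proof -
  interpret B: bernoulli_shift \<beta> \<mu>0 using assms(1,2,4-7) by (rule bernoulli_shift.intro)
  define m :: int where "m = (if \<beta> < 1 / 2 then 0 else 1)"
  define p where "p = [:- real_of_int m, 2:]"
  \<comment> \<open>At this end point of the unit interval \<open>p\<close> takes the value 2 or -1.\<close>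
  define t :: real where "t = 1 - of_int m"
  have "\<beta> \<noteq> 1 / 2"
  proof
    assume "\<beta> = 1 / 2"
    then have "algebraic \<beta>"
      by (intro algebraicI[of "[:-1, 2:]"]) (auto simp: coeff_pCons split: nat.split)
    then show False using assms(3) by simp
  qed
  then have "poly p \<beta> \<in> {0<..<1}"
    using assms(1,2) by (auto simp: p_def m_def)
  moreover have "poly p \<beta> \<in> schwartzman \<Omega> T \<mu>"
    using B.integer_combination_in_schwartzman[of "- m" 2] by (simp add: p_def assms mult.commute)
  ultimately have l: "poly p \<beta> \<in> schwartzman0 \<Omega> T \<mu>" by (simp add: schwartzman0_def)
  have "OG_diag \<Omega> T \<mu> (poly p \<beta>) = {}"
    unfolding assms(8-10)
  proof (rule B.OG_diag_empty[OF assms(3)])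
    show "coeff p i \<in> \<int>" for i by (auto simp: p_def coeff_pCons split: nat.split)
    show "t \<in> {0..1}" "poly p t \<notin> {0..1}" by (auto simp: t_def p_def m_def)
  qed
  with l show ?thesis unfolding DL_def by auto
qed

end
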